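(* Let $i(\Delta(d,n),m)$ denote the Ehrhart polynomial (in the variable $m$) of the hypersimplex $\Delta(d,n)$, regarded as a polynomial with complex argument. Then: (i) For $d=3$ and every integer $n\ge 6$, every root $a\in\mathbb{C}$ of $i(\Delta(3,n),m)$ satisfies $-\frac{n}{3}<\mathrm{Re}(a)<0$. (ii) For every integer $d\ge 4$ there exists an integer $N(d)$ such that for every integer $n\ge N(d)$ (with $n \geq 2d$), every root $a\in\mathbb{C}$ of $i(\Delta(d,n),m)$ satisfies $-\frac{n}{d}<\mathrm{Re}(a)<1$.
   Context: For integers $1\le d<n$, the hypersimplex $\Delta(d,n)\subset\mathbb{R}^n$ is the convex hull of the points $\mathbf{e}_{i_1}+\cdots+\mathbf{e}_{i_d}$ with $1\le i_1<\cdots<i_d\le n$, where $\mathbf{e}_j$ is the $j$-th unit coordinate vector of $\mathbb{R}^n$. For an integral convex polytope $\mathcal{P}\subset\mathbb{R}^n$ (all vertices have integer coordinates), put $i(\mathcal{P},m)=|m\mathcal{P}\cap\mathbb{Z}^n|$ for $m=1,2,\ldots$, where $m\mathcal{P}=\{m\alpha \mid \alpha\in\mathcal{P}\}$. This is a polynomial in $m$ of degree $\dim\mathcal{P}$, called the Ehrhart polynomial of $\mathcal{P}$. For the hypersimplex it is known that $$i(\Delta(d,n),m)=\sum_{s=0}^{d-1}(-1)^s\binom{n}{s}\binom{(d-s)m+n-1-s}{n-1},$$ where $\binom{x}{n-1}=\frac{x(x-1)\cdots(x-n+2)}{(n-1)!}$. Throughout, $d$ and $n$ satisfy $2d\le n$.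 *)

theory Defs
  imports
    "HOL-Analysis.Analysis"
    "HOL-Analysis.Finite_Function_Topology"
    "HOL-Computational_Algebra.Polynomial"
begin

(* The dimension n has to be quantified inside a proposition, so R^n is rendered as the
   subspace of the real vector space of finitely supported functions nat => real whose
   members are supported in {1..n}.  The generic notions of real_vector, convex hull in
   particular, then apply directly. *)

definition integer_lattice :: "nat \<Rightarrow> (nat \<Rightarrow>\<^sub>0 real) set" where
  "integer_lattice n =
     {x. Poly_Mapping.keys x \<subseteq> {1..n} \<and> (\<forall>j\<in>{1..n}. Poly_Mapping.lookup x j \<in> \<int>)}"

definition unit_coord :: "nat \<Rightarrow> (nat \<Rightarrow>\<^sub>0 real)" where
  "unit_coord j = Poly_Mapping.single j 1"

definition hypersimplex :: "nat \<Rightarrow> nat \<Rightarrow> (nat \<Rightarrow>\<^sub>0 real) set" where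
  "hypersimplex d n = convex hull {(\<Sum>j\<in>I. unit_coord j) | I. I \<subseteq> {1..n} \<and> card I = d}"

definition lattice_count :: "nat \<Rightarrow> (nat \<Rightarrow>\<^sub>0 real) set \<Rightarrow> nat \<Rightarrow> nat" where
  "lattice_count n P m = card ((\<lambda>x. real m *\<^sub>R x) ` P \<inter> integer_lattice n)"

(* A polynomial is determined by its values at all m >= 1, so there is at most one such p;
   it exists whenever P is an integral convex polytope in R^n. *)
definition ehrhart_poly :: "nat \<Rightarrow> (nat \<Rightarrow>\<^sub>0 real) set \<Rightarrow> complex poly" where
  "ehrhart_poly n P = (THE p. \<forall>m\<ge>1. poly p (of_nat m) = of_nat (lattice_count n P m))"

end

theory Submission
  imports Defs "HOL-Computational_Algebra.Formal_Power_Series" "HOL-Real_Asymp.Real_Asymp"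
begin

text \<open>
  By Katzman's formula, \<open>(n - 1)!\<close> times the Ehrhart polynomial of the hypersimplex is
  \<open>\<Sum>s<d. (-1)^s (n choose s) H\<^sub>s(z)\<close>, where \<open>H\<^sub>s(z)\<close> is the product of the \<open>n - 1\<close> linear factors
  \<open>(d - s) z + j - s\<close>, \<open>0 < j < n\<close>.  The formula comes from counting integer points of
  \<open>[0,m]^n\<close> with coordinate sum \<open>d m\<close> through the generating function
  \<open>((1 - X^(m+1)) / (1 - X))^n\<close> (\<open>ehrhart_poly_hypersimplex\<close>).

  The leading product \<open>H\<^sub>0\<close> has all its zeros strictly between \<open>-n/d\<close> and \<open>0\<close>.  To the right and to
  the left of the strip in question it outweighs all the other terms together, so the sum cannot
  vanish there (\<open>katzman_poly_nonzero\<close>).  The comparison is made factor by factor: on the closed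
  right half-plane the quotient of two linear functions \<open>a w + p\<close> and \<open>b w + q\<close> is bounded by the
  larger of \<open>a/b\<close> and \<open>\<bar>p\<bar>/q\<close> (\<open>norm_linear_le\<close>).

  For \<open>Re z \<ge> 1\<close> the factor with index \<open>j \<ge> d\<close> contributes a quotient of at most
  \<open>1 - 2 s / (d + j)\<close>; the product of these is of order \<open>n^(-2s)\<close>, which beats the binomial
  coefficient, of order \<open>n^s\<close>.  For \<open>Re z \<le> -n/d\<close> put \<open>z = - w - n/d\<close>.  Passing from \<open>n\<close> to \<open>n + d\<close>
  then keeps all old factors and adds \<open>d\<close> new ones whose quotients are at most \<open>1\<close>, at least one of
  them at most \<open>1 - 1/d\<close> (\<open>shifted_ratio_add\<close>); hence the quotient \<open>H\<^sub>s / H\<^sub>0\<close> decays geometrically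
  in \<open>n\<close>, uniformly in \<open>w\<close>.

  For \<open>d = 3\<close> the quotients, weighted with the binomial coefficients, do not increase when \<open>n\<close> grows
  by \<open>1\<close> on the right and by \<open>3\<close> on the left, so that it is enough to estimate them for a few small
  \<open>n\<close>.  On the right everything rests on \<open>n = 7\<close>, where two linear factors at a time have to be
  compared to get a total below \<open>1\<close>.  For \<open>n = 6\<close> the other terms taken in absolute value add up to
  more than the leading one at some points of the imaginary axis, but the polynomial is an odd
  quintic in \<open>z + 1\<close> whose roots can be bounded directly.
\<close>

section \<open>Lattice points of dilated hypersimplices\<close>

lemma lookup_scaleR: "Poly_Mapping.lookup (r *\<^sub>R x) i = r *\<^sub>R Poly_Mapping.lookup x i"
proof -
  have "finite {i. r *\<^sub>R Poly_Mapping.lookup x i \<noteq> 0}"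
    by (rule finite_subset[OF _ finite_keys[of x]]) (auto simp: in_keys_iff)
  then show ?thesis
    by (simp add: scaleR_poly_mapping_def Abs_poly_mapping_inverse)
qed

lemma lookup_sum_unit_coord:
  assumes "finite I"
  shows "Poly_Mapping.lookup (\<Sum>j\<in>I. unit_coord j) i = (if i \<in> I then 1 else 0)"
  using assms by (simp add: lookup_sum unit_coord_def lookup_single when_def)

lemma hypersimplex_subset_cube_slice:
  "hypersimplex d n \<subseteq>
     {x. Poly_Mapping.keys x \<subseteq> {1..n} \<and> (\<forall>j. 0 \<le> Poly_Mapping.lookup x j \<and> Poly_Mapping.lookup x j \<le> 1)
        \<and> (\<Sum>j\<in>{1..n}. Poly_Mapping.lookup x j) = real d}" (is "_ \<subseteq> ?C")
  unfolding hypersimplex_def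
proof (rule hull_minimal)
  show "{(\<Sum>j\<in>I. unit_coord j) | I. I \<subseteq> {1..n} \<and> card I = d} \<subseteq> ?C"
  proof safe
    fix I :: "nat set" assume I: "I \<subseteq> {1..n}"
    have fin: "finite I" using I finite_subset by blast
    note [simp] = lookup_sum_unit_coord[OF fin]
    show "j \<in> {1..n}" if "j \<in> Poly_Mapping.keys (\<Sum>j\<in>I. unit_coord j)" for j
      using that I by (auto simp: in_keys_iff split: if_splits)
    show "0 \<le> Poly_Mapping.lookup (\<Sum>j\<in>I. unit_coord j) j" 
         "Poly_Mapping.lookup (\<Sum>j\<in>I. unit_coord j) j \<le> 1" for j
      by auto
    show "(\<Sum>j\<in>{1..n}. Poly_Mapping.lookup (\<Sum>j\<in>I. unit_coord j) j) = real (card I)"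
      using I by (simp add: sum.If_cases Int_absorb1)
  qed
  show "convex ?C"
  proof (rule convexI)
    fix x y :: "nat \<Rightarrow>\<^sub>0 real" and u v :: real
    assume xy: "x \<in> ?C" "y \<in> ?C" and uv: "0 \<le> u" "0 \<le> v" "u + v = 1"
    have "Poly_Mapping.lookup (u *\<^sub>R x + v *\<^sub>R y) j =
        u * Poly_Mapping.lookup x j + v * Poly_Mapping.lookup y j" for j
      by (simp add: lookup_add lookup_scaleR)
    note L = this
    have "Poly_Mapping.keys (u *\<^sub>R x + v *\<^sub>R y) \<subseteq> {1..n}"
    proof
      fix j assume "j \<in> Poly_Mapping.keys (u *\<^sub>R x + v *\<^sub>R y)"
      then have "Poly_Mapping.lookup x j \<noteq> 0 \<or> Poly_Mapping.lookup y j \<noteq> 0"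
        by (auto simp: in_keys_iff L)
      then show "j \<in> {1..n}" using xy by (auto simp: in_keys_iff)
    qed
    moreover have "0 \<le> u * Poly_Mapping.lookup x j + v * Poly_Mapping.lookup y j \<and>
        u * Poly_Mapping.lookup x j + v * Poly_Mapping.lookup y j \<le> 1" for j
      using xy uv convex_bound_le[of "Poly_Mapping.lookup x j" 1 "Poly_Mapping.lookup y j" u v]
      by auto
    moreover have "(\<Sum>j\<in>{1..n}. Poly_Mapping.lookup (u *\<^sub>R x + v *\<^sub>R y) j) = real d"
      using xy uv by (simp add: L sum.distrib flip: sum_distrib_left) (simp flip: distrib_right)
    ultimately show "u *\<^sub>R x + v *\<^sub>R y \<in> ?C"
      by (simp add: L)
  qed
qed

text \<open>
  Hypersimplices have the integer decomposition property: an integer point of the \<open>m\<close>-th dilate is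
  a sum of \<open>m\<close> vertices.  A vertex can be split off because at most \<open>d\<close> coordinates attain the
  maximal value \<open>m\<close> and at least \<open>d\<close> are positive, so some \<open>d\<close>-subset contains the former and is
  contained in the latter.
\<close>

lemma box_point_mem_scaled_hypersimplex:
  fixes c :: "nat \<Rightarrow> nat"
  assumes "d \<le> n" and "\<And>j. j \<in> {1..n} \<Longrightarrow> c j \<le> m" and "(\<Sum>j\<in>{1..n}. c j) = d * m"
  shows "\<exists>p\<in>hypersimplex d n. (\<Sum>j\<in>{1..n}. Poly_Mapping.single j (real (c j))) = real m *\<^sub>R p"
  using assms(2,3)
proof (induction m arbitrary: c)
  case 0
  have "(\<Sum>j\<in>{1..d}. unit_coord j) \<in> hypersimplex d n"
    unfolding hypersimplex_def using assms(1) by (intro hull_inc) auto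
  with 0 show ?case by (auto intro!: bexI[of _ "\<Sum>j\<in>{1..d}. unit_coord j"])
next
  case (Suc m)
  define A where "A = {j\<in>{1..n}. c j = Suc m}"
  define B where "B = {j\<in>{1..n}. c j \<ge> 1}"
  have "card A * Suc m = (\<Sum>j\<in>A. c j)" by (simp add: A_def)
  also have "\<dots> \<le> (\<Sum>j\<in>{1..n}. c j)" by (rule sum_mono2) (auto simp: A_def)
  finally have A: "card A \<le> d" using Suc.prems(2) by (simp del: mult_Suc_right)
  have "d * Suc m = (\<Sum>j\<in>{1..n}. c j)" using Suc.prems(2) by simp
  also have "\<dots> = (\<Sum>j\<in>B. c j)"
    by (rule sum.mono_neutral_right) (auto simp: B_def)
  also have "\<dots> \<le> card B * Suc m"
    using sum_bounded_above[of B c "Suc m"] Suc.prems(1) by (auto simp: B_def)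
  finally have B: "d \<le> card B" by (simp del: mult_Suc_right)
  obtain I where I: "A \<subseteq> I" "I \<subseteq> B" "card I = d"
  proof -
    have "A \<subseteq> B" "finite B" by (auto simp: A_def B_def)
    from exists_subset_between[OF A B this] show ?thesis using that by blast
  qed
  have In: "I \<subseteq> {1..n}" using I by (auto simp: B_def)
  define e where "e = (\<lambda>j. if j \<in> I then 1 else 0 :: nat)"
  define c' where "c' j = c j - e j" for j
  have ce: "c j = c' j + e j" for j using I by (auto simp: c'_def e_def B_def)
  have sume: "(\<Sum>j\<in>{1..n}. e j) = d"
    using In I(3) by (simp add: e_def sum.If_cases Int_absorb1)
  have "c' j \<le> m" if "j \<in> {1..n}" for j
    using Suc.prems(1)[OF that] that I(1) by (cases "c j = Suc m") (auto simp: c'_def e_def A_def)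
  moreover have "(\<Sum>j\<in>{1..n}. c' j) = d * m"
    using Suc.prems(2) sume by (simp add: ce sum.distrib)
  ultimately obtain p where p: "p \<in> hypersimplex d n"
    "(\<Sum>j\<in>{1..n}. Poly_Mapping.single j (real (c' j))) = real m *\<^sub>R p"
    using Suc.IH by blast
  define q where "q = (\<Sum>j\<in>I. unit_coord j)"
  have q: "q \<in> hypersimplex d n"
    unfolding hypersimplex_def q_def using In I(3) by (intro hull_inc) auto
  have qe: "(\<Sum>j\<in>{1..n}. Poly_Mapping.single j (real (e j))) = q"
  proof -
    have "(\<Sum>j\<in>{1..n}. Poly_Mapping.single j (real (e j))) = (\<Sum>j\<in>I. Poly_Mapping.single j (real (e j)))"
      using In by (intro sum.mono_neutral_right) (auto simp: e_def)
    also have "\<dots> = q" by (simp add: q_def e_def unit_coord_def)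
    finally show ?thesis .
  qed
  define r where "r = (real m / real (Suc m)) *\<^sub>R p + (1 / real (Suc m)) *\<^sub>R q"
  have "r \<in> hypersimplex d n"
    unfolding r_def using p(1) q
    by (intro convexD[where s = "hypersimplex d n"]) (auto simp: hypersimplex_def field_simps)
  moreover have "(\<Sum>j\<in>{1..n}. Poly_Mapping.single j (real (c j))) = real (Suc m) *\<^sub>R r"
    using p(2) qe by (simp add: ce r_def single_add sum.distrib scaleR_add_right)
  ultimately show ?case by blast
qed

definition bounded_compositions :: "nat \<Rightarrow> nat \<Rightarrow> nat \<Rightarrow> nat list set" where
  "bounded_compositions n m k = {v \<in> natpermute k n. set v \<subseteq> {..m}}"

lemma lattice_count_hypersimplex:
  assumes "d \<le> n" "m \<ge> 1"
  shows "lattice_count n (hypersimplex d n) m = card (bounded_compositions n m (d * m))"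
proof -
  define pt where "pt v = (\<Sum>j\<in>{1..n}. Poly_Mapping.single j (real (v ! (j - 1))))" for v
  have lk: "Poly_Mapping.lookup (pt v) i = (if i \<in> {1..n} then real (v ! (i - 1)) else 0)" for v i
    by (simp add: pt_def lookup_sum lookup_single when_def)
  have shift: "(\<Sum>j\<in>{1..n}. g (j - 1)) = sum g {..<n}" for g :: "nat \<Rightarrow> nat"
    by (rule sum.reindex_bij_witness[of _ Suc "\<lambda>j. j - 1"]) auto
  have suml: "sum_list v = (\<Sum>j\<in>{1..n}. v ! (j - 1))" if "length v = n" for v :: "nat list"
    using that by (simp only: sum_list_sum_nth shift atLeast0LessThan)
  let ?L = "(\<lambda>x. real m *\<^sub>R x) ` hypersimplex d n \<inter> integer_lattice n"
  have "bij_betw pt (bounded_compositions n m (d * m)) ?L"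
  proof (rule bij_betwI')
    fix v w assume vw: "v \<in> bounded_compositions n m (d * m)" "w \<in> bounded_compositions n m (d * m)"
    have "v = w" if eq: "pt v = pt w"
    proof (rule nth_equalityI)
      show "length v = length w" using vw by (simp add: bounded_compositions_def natpermute_def)
      fix i assume "i < length v"
      then have "i < n" using vw by (simp add: bounded_compositions_def natpermute_def)
      then show "v ! i = w ! i"
        using arg_cong[OF eq, of "\<lambda>x. Poly_Mapping.lookup x (Suc i)"] by (simp add: lk)
    qed
    then show "(pt v = pt w) = (v = w)" by blast
  next
    fix v assume v: "v \<in> bounded_compositions n m (d * m)"
    then have len: "length v = n" by (simp add: bounded_compositions_def natpermute_def)
    have "\<exists>p\<in>hypersimplex d n. pt v = real m *\<^sub>R p"
      unfolding pt_def
    proof (rule box_point_mem_scaled_hypersimplex[OF assms(1)])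
      show "v ! (j - 1) \<le> m" if "j \<in> {1..n}" for j
      proof -
        have "v ! (j - 1) \<in> set v" using that len by (intro nth_mem) auto
        then show ?thesis using v by (auto simp: bounded_compositions_def)
      qed
      show "(\<Sum>j\<in>{1..n}. v ! (j - 1)) = d * m"
        using v suml[OF len] by (simp add: bounded_compositions_def natpermute_def)
    qed
    moreover have "pt v \<in> integer_lattice n"
      by (auto simp: integer_lattice_def lk in_keys_iff split: if_splits)
    ultimately show "pt v \<in> ?L" by blast
  next
    fix x assume x: "x \<in> ?L"
    then obtain p where p: "p \<in> hypersimplex d n" "x = real m *\<^sub>R p" by blast
    from p(1) hypersimplex_subset_cube_slice[of d n]
    have pk: "Poly_Mapping.keys p \<subseteq> {1..n}"
      and p01: "\<And>j. 0 \<le> Poly_Mapping.lookup p j \<and> Poly_Mapping.lookup p j \<le> 1"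
      and ps: "(\<Sum>j\<in>{1..n}. Poly_Mapping.lookup p j) = real d" by auto
    have lx: "Poly_Mapping.lookup x j = real m * Poly_Mapping.lookup p j" for j
      by (simp add: p(2) lookup_scaleR)
    define c where "c j = nat \<lfloor>Poly_Mapping.lookup x j\<rfloor>" for j
    have c: "real (c j) = Poly_Mapping.lookup x j" if "j \<in> {1..n}" for j
    proof -
      have "Poly_Mapping.lookup x j \<in> \<int>" using x that by (auto simp: integer_lattice_def)
      moreover have "Poly_Mapping.lookup x j \<ge> 0" using p01[of j] by (simp add: lx)
      ultimately show ?thesis by (auto simp: c_def elim!: Ints_cases)
    qed
    have cm: "c j \<le> m" if "j \<in> {1..n}" for j
    proof -
      have "real (c j) \<le> real m * 1" unfolding c[OF that] lx using p01[of j] by (intro mult_left_mono) auto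
      then show ?thesis by simp
    qed
    have "real (\<Sum>j\<in>{1..n}. c j) = (\<Sum>j\<in>{1..n}. real m * Poly_Mapping.lookup p j)"
      by (simp add: c lx del: of_nat_sum add: of_nat_sum)
    also have "\<dots> = real (d * m)" unfolding sum_distrib_left[symmetric] ps by simp
    finally have cs: "(\<Sum>j\<in>{1..n}. c j) = d * m" by (simp only: of_nat_eq_iff)
    define v where "v = map (\<lambda>i. c (Suc i)) [0..<n]"
    have len: "length v = n" by (simp add: v_def)
    have nth: "v ! (j - 1) = c j" if "j \<in> {1..n}" for j using that by (auto simp: v_def)
    have "v \<in> bounded_compositions n m (d * m)"
      using suml[OF len] cs nth cm len by (auto simp: bounded_compositions_def natpermute_def v_def)
    moreover have "x = pt v"
    proof (rule poly_mapping_eqI)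
      fix i show "Poly_Mapping.lookup x i = Poly_Mapping.lookup (pt v) i"
        using pk c[of i] nth[of i] by (cases "i \<in> {1..n}") (auto simp: lk lx in_keys_iff)
    qed
    ultimately show "\<exists>v\<in>bounded_compositions n m (d * m). x = pt v" by blast
  qed
  then show ?thesis by (simp add: lattice_count_def bij_betw_same_card)
qed

text \<open>
  The negative binomial series, in the product form that is valid over any commutative ring.
\<close>

lemma one_minus_fps_X_power_mult_binomials:
  "(1 - fps_X) ^ Suc n * Abs_fps (\<lambda>k. of_nat ((n + k) choose n)) = (1 :: 'a :: comm_ring_1 fps)"
proof (induction n)
  case 0
  show ?case by (rule fps_ext) (auto simp: left_diff_distrib)
next
  case (Suc n)
  have "(1 - fps_X) * Abs_fps (\<lambda>k. of_nat ((Suc n + k) choose Suc n)) =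
      (Abs_fps (\<lambda>k. of_nat ((n + k) choose n)) :: 'a fps)"
  proof (rule fps_ext)
    fix k show "fps_nth ((1 - fps_X) * Abs_fps (\<lambda>k. of_nat ((Suc n + k) choose Suc n))) k =
      fps_nth (Abs_fps (\<lambda>k. of_nat ((n + k) choose n)) :: 'a fps) k"
      by (cases k) (simp_all add: left_diff_distrib binomial_eq_0)
  qed
  then show ?case using Suc by (simp add: power_Suc2 mult.assoc del: power_Suc)
qed

text \<open>
  The number of bounded compositions is a coefficient of \<open>(1 + X + \<dots> + X^m)^n\<close>, which equals
  \<open>(1 - X^(m+1))^n\<close> times the series of \<open>(1 - X)^(-n)\<close>.  The case distinction drops
  the terms with \<open>X^(s(m+1))\<close> of degree above \<open>k\<close>.
\<close>

lemma card_bounded_compositions: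
  assumes "n \<ge> 1"
  shows "int (card (bounded_compositions n m k)) =
     (\<Sum>s\<le>n. (-1) ^ s * int (n choose s) *
         (if k < s * Suc m then 0 else int ((n - 1 + (k - s * Suc m)) choose (n - 1))))"
proof -
  obtain n' where n': "n = Suc n'" using assms by (cases n) auto
  define P :: "int fps" where "P = Abs_fps (\<lambda>i. if i \<le> m then 1 else 0)"
  define G :: "int fps" where "G = Abs_fps (\<lambda>k. int ((n' + k) choose n'))"
  have "fps_nth (P ^ n) k = (\<Sum>v\<in>natpermute k n. \<Prod>j\<in>{0..n'}. fps_nth P (v ! j))"
    unfolding n' by (simp add: fps_power_nth_Suc del: power_Suc)
  also have "\<dots> = (\<Sum>v\<in>natpermute k n. if set v \<subseteq> {..m} then 1 else 0)"
  proof (rule sum.cong[OF refl])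
    fix v assume "v \<in> natpermute k n"
    then have len: "length v = Suc n'" by (simp add: natpermute_def n')
    have "(\<Prod>j\<in>{0..n'}. fps_nth P (v ! j)) = (if \<forall>j\<in>{0..n'}. v ! j \<le> m then 1 else 0)"
      by (auto simp: P_def intro: prod.neutral)
    also have "(\<forall>j\<in>{0..n'}. v ! j \<le> m) \<longleftrightarrow> set v \<subseteq> {..m}"
    proof -
      have "set v \<subseteq> {..m} \<longleftrightarrow> (\<forall>x\<in>set v. x \<le> m)" by auto
      then show ?thesis using len by (auto simp: all_set_conv_all_nth less_Suc_eq_le)
    qed
    finally show "(\<Prod>j\<in>{0..n'}. fps_nth P (v ! j)) = (if set v \<subseteq> {..m} then 1 else 0)" .
  qed
  also have "\<dots> = int (card (bounded_compositions n m k))"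
    by (simp add: sum.If_cases natpermute_finite bounded_compositions_def Collect_conj_eq Int_commute)
  finally have lhs: "fps_nth (P ^ n) k = int (card (bounded_compositions n m k))" .
  have P1: "(1 - fps_X) * P = 1 - fps_X ^ Suc m"
  proof (rule fps_ext)
    fix i show "fps_nth ((1 - fps_X) * P) i = fps_nth (1 - fps_X ^ Suc m) i"
      by (cases i) (auto simp: P_def left_diff_distrib fps_X_power_nth simp del: power_Suc)
  qed
  have "P ^ n = P ^ n * ((1 - fps_X) ^ n * G)"
    using one_minus_fps_X_power_mult_binomials[of n', where ?'a = int] by (simp add: n' G_def)
  also have "\<dots> = (1 - fps_X ^ Suc m) ^ n * G"
    by (simp only: mult.assoc[symmetric] power_mult_distrib[symmetric]) (simp only: P1 mult.commute[of P])
  also have "(1 - fps_X ^ Suc m) ^ n = (\<Sum>s\<le>n. of_nat (n choose s) * (- (fps_X ^ Suc m)) ^ s * 1 ^ (n - s) :: int fps)"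
    using binomial_ring[of "- (fps_X ^ Suc m) :: int fps" 1 n] by simp
  also have "\<dots> = (\<Sum>s\<le>n. fps_const ((-1) ^ s * int (n choose s)) * fps_X ^ (s * Suc m))"
    by (intro sum.cong refl)
       (simp add: power_minus[of "fps_X ^ Suc m"] fps_of_nat[symmetric] fps_const_neg[symmetric] power_mult[symmetric] mult.commute del: power_Suc fps_const_neg
         flip: fps_const_mult fps_const_power)
  finally have "P ^ n = (\<Sum>s\<le>n. fps_const ((-1) ^ s * int (n choose s)) * (fps_X ^ (s * Suc m) * G))"
    by (simp add: sum_distrib_right mult.assoc)
  then have "fps_nth (P ^ n) k = (\<Sum>s\<le>n. (-1) ^ s * int (n choose s) * (if k < s * Suc m then 0 else fps_nth G (k - s * Suc m)))"
    by (simp add: fps_sum_nth fps_X_power_mult_nth del: mult_Suc_right)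
  moreover have "n' = n - 1" by (simp add: n')
  ultimately show ?thesis by (simp add: lhs G_def del: mult_Suc_right sum.atMost_Suc cong: if_cong)
qed


section \<open>The Ehrhart polynomial as a sum of products of linear factors\<close>

text \<open>
  This is \<open>(n - 1)!\<close> times the binomial coefficient of \<open>(d - s) z + n - 1 - s\<close> over \<open>n - 1\<close>.  The
  difference \<open>d - s\<close> is taken in the complex numbers, where it does not truncate.
\<close>

definition hyp_prod :: "nat \<Rightarrow> nat \<Rightarrow> nat \<Rightarrow> complex \<Rightarrow> complex" where
  "hyp_prod d s n z = (\<Prod>j=1..<n. (of_nat d - of_nat s) * z + of_nat j - of_nat s)"

text \<open>
  Katzman's formula for the Ehrhart polynomial of a hypersimplex.
\<close>

definition katzman_poly :: "nat \<Rightarrow> nat \<Rightarrow> complex poly" where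
  "katzman_poly d n = (\<Sum>s<d. smult ((-1) ^ s * of_nat (n choose s) / fact (n - 1))
     (\<Prod>j=1..<n. [:of_nat j - of_nat s, of_nat d - of_nat s:]))"

lemma poly_katzman_poly:
  "poly (katzman_poly d n) z =
     (\<Sum>s<d. (-1) ^ s * of_nat (n choose s) / fact (n - 1) * hyp_prod d s n z)"
  by (simp add: katzman_poly_def poly_sum poly_prod hyp_prod_def algebra_simps)

lemma prod_shift_mult_fact: "(\<Prod>j=1..<Suc p. k + j) * fact k = (fact (p + k) :: nat)"
  by (induction p) (simp_all add: algebra_simps)

text \<open>
  The formula counts with polynomial binomial coefficients, the lattice points are counted with
  combinatorial ones.  They agree also for \<open>(d - s) m < s\<close>, because then the factor with
  \<open>j = s - (d - s) m\<close> vanishes.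
\<close>

lemma hyp_prod_of_nat:
  assumes "s < d" "d \<le> n" "m \<ge> 1"
  shows "hyp_prod d s n (of_nat m) / fact (n - 1) =
     of_nat (if d * m < s * Suc m then 0 else (n - 1 + (d * m - s * Suc m)) choose (n - 1))"
proof (cases "d * m < s * Suc m")
  case True
  define j where "j = s * Suc m - d * m"
  have "s * m + m \<le> d * m" using mult_le_mono1[of "Suc s" d m] assms(1) by simp
  then have "j < s" "j \<ge> 1" using True assms(3) by (auto simp: j_def)
  moreover have "(of_nat d - of_nat s) * of_nat m + of_nat j - of_nat s = (0 :: complex)"
    using True by (simp add: j_def of_nat_diff algebra_simps del: mult_Suc_right)
  ultimately show ?thesis
    using True assms by (auto simp: hyp_prod_def prod_zero_iff intro!: bexI[of _ j])
next
  case False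
  define k where "k = d * m - s * Suc m"
  have k: "of_nat k = ((of_nat d - of_nat s) * of_nat m - of_nat s :: complex)"
    using False by (simp add: k_def of_nat_diff algebra_simps)
  obtain p where p: "n = Suc p" using assms by (cases n) auto
  have "hyp_prod d s n (of_nat m) = of_nat (\<Prod>j=1..<n. k + j)"
    by (simp add: hyp_prod_def k of_nat_prod algebra_simps)
  moreover have "(\<Prod>j=1..<n. k + j) = (p + k choose p) * fact p"
    using prod_shift_mult_fact[of k p] binomial_fact_lemma[of p "p + k"]
    by (simp add: p del: prod.op_ivl_Suc) (metis fact_nonzero mult.assoc mult.commute mult_cancel2)
  ultimately show ?thesis using False by (simp add: k_def p del: mult_Suc_right)
qed

lemma ehrhart_poly_hypersimplex:
  assumes "1 \<le> d" "d \<le> n"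
  shows "ehrhart_poly n (hypersimplex d n) = katzman_poly d n"
proof -
  have val: "poly (katzman_poly d n) (of_nat m) = of_nat (lattice_count n (hypersimplex d n) m)"
    if m: "m \<ge> 1" for m
  proof -
    define t where "t s = (if d * m < s * Suc m then 0 else (n - 1 + (d * m - s * Suc m)) choose (n - 1))" for s
    have t0: "t s = 0" if "d \<le> s" for s
    proof -
      have "d * m \<le> s * m" "1 \<le> s" using that assms by auto
      then have "d * m < s * Suc m" unfolding mult_Suc_right by linarith
      then show ?thesis by (simp add: t_def)
    qed
    have "int (lattice_count n (hypersimplex d n) m) = (\<Sum>s\<le>n. (-1) ^ s * int (n choose s) * int (t s))"
      unfolding lattice_count_hypersimplex[OF assms(2) m] 
      using card_bounded_compositions[of n m "d * m"] assms
      by (simp add: t_def if_distrib cong: if_cong)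
    also have "\<dots> = (\<Sum>s<d. (-1) ^ s * int (n choose s) * int (t s))"
      using assms by (intro sum.mono_neutral_right) (auto simp: t0)
    finally have "complex_of_int (int (lattice_count n (hypersimplex d n) m)) =
      complex_of_int (\<Sum>s<d. (-1) ^ s * int (n choose s) * int (t s))" by (rule arg_cong)
    then have "complex_of_nat (lattice_count n (hypersimplex d n) m) =
      (\<Sum>s<d. (-1) ^ s * of_nat (n choose s) * of_nat (t s))"
      by simp
    also have "\<dots> = poly (katzman_poly d n) (of_nat m)"
      unfolding poly_katzman_poly
      by (intro sum.cong refl) (simp add: t_def hyp_prod_of_nat[OF _ assms(2) m, symmetric] del: mult_Suc_right of_nat_mult)
    finally show ?thesis by simp
  qed
  show ?thesis
    unfolding ehrhart_poly_def
  proof (rule the_equality)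
    show "\<forall>m\<ge>1. poly (katzman_poly d n) (of_nat m) = of_nat (lattice_count n (hypersimplex d n) m)"
      using val by blast
    fix q :: "complex poly" assume q: "\<forall>m\<ge>1. poly q (of_nat m) = of_nat (lattice_count n (hypersimplex d n) m)"
    show "q = katzman_poly d n"
    proof (rule ccontr)
      assume "q \<noteq> katzman_poly d n"
      then have "finite {z. poly (q - katzman_poly d n) z = 0}" by (intro poly_roots_finite) simp
      moreover have "of_nat ` {1..} \<subseteq> {z. poly (q - katzman_poly d n) z = 0}"
        using q val by auto
      ultimately have "finite (of_nat ` {1::nat..} :: complex set)" using finite_subset by blast
      then have "finite {1::nat..}"
        by (rule finite_imageD) (simp add: inj_on_def)
      then show False by (simp add: infinite_Ici)
    qed
  qed
qed

section \<open>Domination by the leading product\<close>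

text \<open>
  For \<open>Re w \<ge> 0\<close> both the real and the imaginary part of \<open>a w + p\<close> are, in absolute value, at most
  those of \<open>c (b w + q)\<close>.  All comparisons of products below reduce to this one.
\<close>

lemma norm_linear_le:
  assumes "0 \<le> Re w" "0 \<le> a" "0 \<le> c" "a \<le> c * b" "\<bar>p\<bar> \<le> c * q"
  shows "cmod (of_real a * w + of_real p) \<le> c * cmod (of_real b * w + of_real q)"
proof -
  have "\<bar>a * Re w + p\<bar> \<le> a * Re w + \<bar>p\<bar>"
    using assms(1,2) abs_triangle_ineq[of "a * Re w" p] by simp
  also have "\<dots> \<le> c * b * Re w + c * q" using assms by (intro add_mono mult_right_mono)
  finally have 1: "\<bar>a * Re w + p\<bar> \<le> \<bar>c * b * Re w + c * q\<bar>" by linarith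
  have 2: "\<bar>a * Im w\<bar> \<le> \<bar>c * b * Im w\<bar>"
    using assms(2,4) by (simp add: abs_mult[of a] abs_mult[of "c * b"] mult_right_mono)
  have "cmod (of_real a * w + of_real p) \<le> cmod (of_real (c * b) * w + of_real (c * q))"
    unfolding cmod_def using 1 2 by (intro real_sqrt_le_mono add_mono) (simp_all add: abs_le_square_iff)
  also have "of_real (c * b) * w + of_real (c * q) = of_real c * (of_real b * w + of_real q :: complex)"
    by (simp add: algebra_simps)
  also have "cmod \<dots> = c * cmod (of_real b * w + of_real q)"
    using assms(3) by (simp only: norm_mult norm_of_real abs_of_nonneg)
  finally show ?thesis .
qed

lemma katzman_poly_nonzero:
  assumes "0 < d" "(\<Sum>s=1..<d. real (n choose s) * cmod (hyp_prod d s n z)) < cmod (hyp_prod d 0 n z)"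
  shows "poly (katzman_poly d n) z \<noteq> 0"
proof
  assume "poly (katzman_poly d n) z = 0"
  define t where "t s = (-1) ^ s * of_nat (n choose s) * hyp_prod d s n z" for s
  have "fact (n - 1) * poly (katzman_poly d n) z = (\<Sum>s<d. t s)"
    by (simp add: poly_katzman_poly sum_distrib_left t_def)
  also have "\<dots> = t 0 + (\<Sum>s=1..<d. t s)"
    using sum.atLeast_Suc_lessThan[OF assms(1), of t] by (simp add: atLeast0LessThan)
  finally have "hyp_prod d 0 n z = - (\<Sum>s=1..<d. t s)"
    using \<open>poly _ z = 0\<close> by (simp add: t_def eq_neg_iff_add_eq_0)
  then have "cmod (hyp_prod d 0 n z) \<le> (\<Sum>s=1..<d. cmod (t s))"
    by (simp add: norm_sum)
  also have "\<dots> = (\<Sum>s=1..<d. real (n choose s) * cmod (hyp_prod d s n z))"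
    by (simp add: t_def norm_mult norm_power)
  finally show False using assms(2) by simp
qed


section \<open>The half-plane to the right of the strip\<close>

lemma hyp_prod_Suc:
  "n \<ge> 1 \<Longrightarrow> hyp_prod d s (Suc n) z = hyp_prod d s n z * ((of_nat d - of_nat s) * z + of_nat n - of_nat s)"
  by (simp add: hyp_prod_def)

text \<open>
  The comparison of one factor of \<open>hyp_prod d s n\<close> with the corresponding factor of
  \<open>hyp_prod d 0 n\<close>, on the half-plane to the right of the real point \<open>x\<close>.
\<close>

lemma norm_hyp_factor_le:
  assumes "0 \<le> Re z" "s \<le> d" "0 \<le> c" "real d - real s \<le> c * real d"
    "\<bar>(real d - real s) * x + real j - real s\<bar> \<le> c * (real d * x + real j)"
  shows "cmod ((of_nat d - of_nat s) * (of_real x + z) + of_nat j - of_nat s)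
         \<le> c * cmod (of_nat d * (of_real x + z) + of_nat j)"
proof -
  have "cmod (of_real (real d - real s) * z + of_real ((real d - real s) * x + real j - real s))
      \<le> c * cmod (of_real (real d) * z + of_real (real d * x + real j))"
    using assms by (intro norm_linear_le) auto
  then show ?thesis by (simp add: algebra_simps)
qed

text \<open>
  On the right half-plane the new factor has a quotient of at most \<open>(n - s) / n\<close>, and this
  compensates for the growth \<open>(n + 1) / (n + 1 - s)\<close> of the binomial coefficient.  A bound for one
  \<open>n\<close> therefore persists for all larger ones.
\<close>

lemma weighted_ratio_Suc:
  assumes "0 \<le> Re z" "s \<le> d" "d \<le> n" "1 \<le> n"
    and le: "real (n choose s) * cmod (hyp_prod d s n z) \<le> K * cmod (hyp_prod d 0 n z)"
  shows "real (Suc n choose s) * cmod (hyp_prod d s (Suc n) z) \<le> K * cmod (hyp_prod d 0 (Suc n) z)"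
proof -
  define c where "c = (real n - real s) / real n"
  have c: "0 \<le> c" using assms by (simp add: c_def)
  let ?u = "cmod ((of_nat d - of_nat s) * z + of_nat n - of_nat s)"
  let ?v = "cmod (of_nat d * z + of_nat n)"
  have sd: "real s * real d \<le> real s * real n" using assms by (intro mult_left_mono) auto
  have u: "?u \<le> c * ?v"
    using norm_hyp_factor_le[of z s d c 0 n] assms c sd by (simp add: c_def field_simps)
  have "(Suc n - s) * (Suc n choose s) = Suc n * (n choose s)"
    using binomial_absorb_comp[of "Suc n" s] by simp
  then have "real (Suc n - s) * real (Suc n choose s) = real (Suc n) * real (n choose s)"
    by (metis of_nat_mult)
  then have eq: "real (Suc n choose s) = (real n + 1) / (real n + 1 - real s) * real (n choose s)"
    using assms by (simp add: of_nat_diff field_simps)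
  have "(real n + 1) * (real n - real s) \<le> (real n + 1 - real s) * real n"
    by (simp add: algebra_simps)
  moreover have "0 < (real n + 1 - real s) * real n" using assms by simp
  ultimately have "(real n + 1) / (real n + 1 - real s) * c \<le> 1"
    by (simp add: c_def divide_le_eq_1_pos)
  then have w: "real (Suc n choose s) * c \<le> real (n choose s)"
    unfolding eq using mult_right_mono[of "(real n + 1) / (real n + 1 - real s) * c" 1 "real (n choose s)"]
    by (simp add: mult_ac)
  have "real (Suc n choose s) * cmod (hyp_prod d s (Suc n) z)
     = real (Suc n choose s) * (cmod (hyp_prod d s n z) * ?u)"
    by (simp only: hyp_prod_Suc[OF assms(4)] norm_mult)
  also have "\<dots> \<le> real (Suc n choose s) * (cmod (hyp_prod d s n z) * (c * ?v))"
    using u by (intro mult_left_mono) auto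
  also have "\<dots> = (real (Suc n choose s) * c) * (cmod (hyp_prod d s n z) * ?v)"
    by (simp only: mult_ac)
  also have "\<dots> \<le> real (n choose s) * (cmod (hyp_prod d s n z) * ?v)"
    using w by (intro mult_right_mono) auto
  also have "\<dots> \<le> K * cmod (hyp_prod d 0 n z) * ?v"
    using mult_right_mono[OF le, of ?v] by (simp add: mult_ac)
  also have "\<dots> = K * cmod (hyp_prod d 0 (Suc n) z)"
    by (simp add: hyp_prod_Suc[OF assms(4)] norm_mult)
  finally show ?thesis .
qed

text \<open>
  By Bernoulli's inequality the quotient \<open>1 - 2 s / (d + j)\<close> of the factors with index \<open>j \<ge> d\<close> is at
  most \<open>((d + j - 1) / (d + j))^(2 s)\<close>, and the product of the latter telescopes.
\<close>

lemma hyp_prod_ratio_le_right: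
  assumes "1 \<le> Re z" "1 \<le> s" "s < d" "d \<le> n"
  shows "cmod (hyp_prod d s n z) \<le> (2 * real d / (real d + real n - 1)) ^ (2 * s) * cmod (hyp_prod d 0 n z)"
  using assms(4)
proof (induction n rule: nat_induct_at_least)
  case base
  have "cmod (hyp_prod d s d z) \<le> cmod (hyp_prod d 0 d z)"
    unfolding hyp_prod_def prod_norm[symmetric]
  proof (rule prod_mono, safe)
    fix j assume "j \<in> {1..<d}"
    have "\<bar>real d - real s + real j - real s\<bar> \<le> real d + real j"
      using assms by (auto simp: abs_le_iff)
    then show "cmod ((of_nat d - of_nat s) * z + of_nat j - of_nat s)
        \<le> cmod ((of_nat d - of_nat 0) * z + of_nat j - of_nat 0)"
      using norm_hyp_factor_le[of "z - 1" s d 1 1 j] assms by simp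
  qed auto
  also have "1 \<le> (2 * real d / (real d + real d - 1)) ^ (2 * s)"
    using assms by (intro one_le_power) auto
  then have "cmod (hyp_prod d 0 d z) \<le> (2 * real d / (real d + real d - 1)) ^ (2 * s) * cmod (hyp_prod d 0 d z)"
    using mult_right_mono[OF _ norm_ge_zero, of 1] by simp
  finally show ?case .
next
  case (Suc n)
  have n1: "n \<ge> 1" using Suc.hyps assms by simp
  define c where "c = 1 - 2 * real s / (real d + real n)"
  have sd: "real s * real d \<le> real s * real n" using Suc.hyps by (intro mult_left_mono) auto
  have c: "0 \<le> c" using assms Suc.hyps by (simp add: c_def field_simps)
  let ?u = "cmod ((of_nat d - of_nat s) * z + of_nat n - of_nat s)"
  let ?v = "cmod (of_nat d * z + of_nat n)"
  have cd: "real d - real s \<le> c * real d"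
    using assms Suc.hyps sd by (simp add: c_def field_simps)
  have cp: "c * (real d + real n) = real d + real n - 2 * real s"
    using n1 by (simp add: c_def field_simps)
  have u: "?u \<le> c * ?v"
    using norm_hyp_factor_le[of "z - 1" s d c 1 n] assms Suc.hyps c cd cp by simp
  \<comment> \<open>Bernoulli turns the quotient into a power of a telescoping factor\<close>
  have "1 + real (2 * s) * (- (1 / (real d + real n))) \<le> (1 + (- (1 / (real d + real n)))) ^ (2 * s)"
    using n1 by (intro Bernoulli_inequality) (simp add: field_simps)
  then have "c \<le> ((real d + real n - 1) / (real d + real n)) ^ (2 * s)"
    using n1 by (simp add: c_def diff_divide_distrib)
  with u have u': "?u \<le> ((real d + real n - 1) / (real d + real n)) ^ (2 * s) * ?v"
    by (meson mult_right_mono norm_ge_zero order_trans)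
  have "cmod (hyp_prod d s (Suc n) z) = cmod (hyp_prod d s n z) * ?u"
    by (simp only: hyp_prod_Suc[OF n1] norm_mult)
  also have "\<dots> \<le> ((2 * real d / (real d + real n - 1)) ^ (2 * s) * cmod (hyp_prod d 0 n z)) *
      (((real d + real n - 1) / (real d + real n)) ^ (2 * s) * ?v)"
    using Suc.IH u' n1 by (intro mult_mono) auto
  also have "\<dots> = ((2 * real d / (real d + real n - 1)) * ((real d + real n - 1) / (real d + real n))) ^ (2 * s)
      * (cmod (hyp_prod d 0 n z) * ?v)"
    by (simp only: power_mult_distrib mult_ac)
  also have "(2 * real d / (real d + real n - 1)) * ((real d + real n - 1) / (real d + real n))
      = 2 * real d / (real d + real (Suc n) - 1)"
  proof -
    have "real d + real n - 1 \<noteq> 0" using n1 assms by simp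
    then have "a / (real d + real n - 1) * ((real d + real n - 1) / y) = a / y" for a y
      by (simp only: times_divide_times_eq mult.commute[of a] mult_divide_mult_cancel_left_if if_False)
    then show ?thesis by simp
  qed
  also have "cmod (hyp_prod d 0 n z) * ?v = cmod (hyp_prod d 0 (Suc n) z)"
    by (simp add: hyp_prod_Suc[OF n1] norm_mult)
  finally show ?case .
qed

lemma hyp_prod_pos:
  assumes "0 \<le> Re z"
  shows "0 < cmod (hyp_prod d 0 n z)"
proof -
  have "of_nat d * z + of_nat j \<noteq> 0" if "j \<ge> 1" for j
  proof
    assume "of_nat d * z + of_nat j = 0"
    then have "Re (of_nat d * z + of_nat j) = 0" by simp
    then show False using assms that by (auto simp: add_nonneg_eq_0_iff)
  qed
  then show ?thesis by (auto simp: hyp_prod_def)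
qed

text \<open>
  With \<open>q = 4 d\<^sup>2 / n\<close> the \<open>s\<close>-th term is at most \<open>q^s \<le> q\<close> times the leading one, and there are
  \<open>d - 1\<close> such terms; this explains the bound \<open>4 d\<^sup>3\<close>.
\<close>

lemma root_Re_less_1:
  assumes "1 \<le> d" "4 * d ^ 3 \<le> n" "poly (katzman_poly d n) z = 0"
  shows "Re z < 1"
proof (rule ccontr)
  assume "\<not> Re z < 1"
  then have z: "1 \<le> Re z" by simp
  have d3: "real d \<le> real d ^ 3" "real d ^ 2 \<le> real d ^ 3" using assms(1)
    by (simp_all add: self_le_power power_increasing)
  have n: "4 * real d ^ 3 \<le> real n" using assms(2) by (metis of_nat_le_iff of_nat_mult of_nat_numeral of_nat_power)
  have n0: "0 < real n" and dn: "d \<le> n" using n d3 assms(1) by linarith+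
  define q where "q = 4 * real d ^ 2 / real n"
  have q: "0 \<le> q" "q \<le> 1" "real d * q \<le> 1"
    using n n0 d3 by (auto simp: q_def field_simps power3_eq_cube power2_eq_square)
  have "real (n choose s) * cmod (hyp_prod d s n z) \<le> q * cmod (hyp_prod d 0 n z)" if s: "s \<in> {1..<d}" for s
  proof -
    have "real (n choose s) * cmod (hyp_prod d s n z) \<le>
       real n ^ s * ((2 * real d / (real d + real n - 1)) ^ (2 * s) * cmod (hyp_prod d 0 n z))"
      using s dn z hyp_prod_ratio_le_right[of z s d n] binomial_le_pow[of s n]
      by (intro mult_mono) (auto simp flip: of_nat_power)
    also have "\<dots> \<le> real n ^ s * ((2 * real d / real n) ^ (2 * s) * cmod (hyp_prod d 0 n z))"
      using n0 assms(1) by (intro mult_left_mono mult_right_mono power_mono divide_left_mono) auto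
    also have "\<dots> = q ^ s * cmod (hyp_prod d 0 n z)"
    proof -
      have "q = real n * (2 * real d / real n) ^ 2"
        using n0 by (simp add: q_def power_divide power2_eq_square)
      then show ?thesis by (simp only: power_mult power_mult_distrib mult.assoc)
    qed
    also have "\<dots> \<le> q ^ 1 * cmod (hyp_prod d 0 n z)"
      using q s by (intro mult_right_mono power_decreasing) auto
    finally show ?thesis by simp
  qed
  then have "(\<Sum>s=1..<d. real (n choose s) * cmod (hyp_prod d s n z)) \<le> (\<Sum>s=1..<d. q * cmod (hyp_prod d 0 n z))"
    by (rule sum_mono)
  also have "\<dots> = (real d - 1) * q * cmod (hyp_prod d 0 n z)"
    using assms(1) by (simp add: of_nat_diff)
  also have "\<dots> < 1 * cmod (hyp_prod d 0 n z)"
  proof (rule mult_strict_right_mono)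
    have "0 < q" using assms(1) n0 by (simp add: q_def)
    then show "(real d - 1) * q < 1" using q by (simp add: left_diff_distrib)
    show "0 < cmod (hyp_prod d 0 n z)" using z by (intro hyp_prod_pos) simp
  qed
  finally show False
    using katzman_poly_nonzero[of d n z] assms(1,3) by simp
qed

section \<open>The half-plane to the left of the strip\<close>

text \<open>
  Up to sign this is \<open>hyp_prod d s n\<close> at \<open>- w - n/d\<close>, with the order of the factors reversed.  The
  half-plane \<open>Re z \<le> - n/d\<close> becomes \<open>Re w \<ge> 0\<close>, and the leading product \<open>s = 0\<close> keeps its form.
\<close>

definition shifted_prod :: "nat \<Rightarrow> nat \<Rightarrow> nat \<Rightarrow> complex \<Rightarrow> complex" where
  "shifted_prod d s n w = (\<Prod>j=1..<n. of_real (real d - real s) * w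
      + of_real (real j + real s - real s * real n / real d))"

lemma norm_hyp_prod_eq_shifted:
  assumes "0 < d"
  shows "cmod (hyp_prod d s n (- w - of_real (real n / real d))) = cmod (shifted_prod d s n w)"
proof -
  have "hyp_prod d s n (- w - of_real (real n / real d)) =
     (\<Prod>j=1..<n. (of_nat d - of_nat s) * (- w - of_real (real n / real d)) + of_nat (n + 1 - Suc j) - of_nat s)"
    unfolding hyp_prod_def by (subst prod.atLeastLessThan_rev) (simp add: add.commute)
  also have "\<dots> = (\<Prod>j=1..<n. - (of_real (real d - real s) * w
      + of_real (real j + real s - real s * real n / real d)))"
    using assms by (intro prod.cong refl) (simp add: of_nat_diff field_simps)
  finally show ?thesis
    by (simp only: shifted_prod_def prod_norm[symmetric] norm_minus_cancel)
qed

text \<open>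
  The offset \<open>s n / d\<close> grows by the integer \<open>s\<close> when \<open>n\<close> grows by \<open>d\<close>.  Hence the old factors
  reappear with their index shifted by \<open>s\<close>, together with \<open>s\<close> new ones before and \<open>d - s\<close> new ones
  after them.
\<close>

lemma shifted_prod_add:
  assumes "0 < d" "s \<le> d" "1 \<le> n"
  shows "shifted_prod d s (n + d) w =
     (\<Prod>i<s. of_real (real d - real s) * w - of_real (real s * real n / real d - real s + real i))
     * shifted_prod d s n w
     * (\<Prod>i<d - s. of_real (real d - real s) * w + of_real (real n + real s + real i - real s * real n / real d))"
proof -
  define f where "f j = of_real (real d - real s) * w + of_real (real j - real s * real n / real d)" for j
  have "shifted_prod d s (n + d) w = prod f {1..<n + d}"
    unfolding shifted_prod_def f_def
    using assms by (intro prod.cong refl arg_cong2[where f = "(+)"] arg_cong[where f = of_real]) (simp add: field_simps)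
  also have "\<dots> = prod f {1..<s + 1} * prod f {s + 1..<s + n} * prod f {s + n..<n + d}"
  proof -
    have "prod f {1..<s + 1} * prod f {s + 1..<s + n} = prod f {1..<s + n}"
      using assms by (intro prod.atLeastLessThan_concat) auto
    moreover have "prod f {1..<s + n} * prod f {s + n..<n + d} = prod f {1..<n + d}"
      using assms by (intro prod.atLeastLessThan_concat) auto
    ultimately show ?thesis by metis
  qed
  also have "prod f {1..<s + 1} = (\<Prod>i<s. f (s - i))"
    by (rule prod.reindex_bij_witness[of _ "\<lambda>i. s - i" "\<lambda>j. s - j"]) auto
  also have "\<dots> = (\<Prod>i<s. of_real (real d - real s) * w - of_real (real s * real n / real d - real s + real i))"
    by (intro prod.cong refl) (simp add: f_def of_nat_diff algebra_simps)
  also have "prod f {s + 1..<s + n} = shifted_prod d s n w"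
    unfolding shifted_prod_def
    by (rule prod.reindex_bij_witness[of _ "\<lambda>j. j + s" "\<lambda>j. j - s"]) (auto simp: f_def algebra_simps)
  also have "prod f {s + n..<n + d} = (\<Prod>i<d - s. f (s + n + i))"
    by (rule prod.reindex_bij_witness[of _ "\<lambda>i. s + n + i" "\<lambda>j. j - (s + n)"]) auto
  also have "\<dots> = (\<Prod>i<d - s. of_real (real d - real s) * w + of_real (real n + real s + real i - real s * real n / real d))"
    by (intro prod.cong refl) (simp add: f_def algebra_simps)
  finally show ?thesis .
qed

text \<open>
  A bound for the growth of the quotient of \<open>shifted_prod d s\<close> and \<open>shifted_prod d 0\<close> from \<open>n\<close> to
  \<open>n + d\<close>: the power accounts for the \<open>s\<close> new factors before the old ones, the product for the
  \<open>d - s\<close> new factors after them.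
\<close>

definition step_factor :: "nat \<Rightarrow> nat \<Rightarrow> nat \<Rightarrow> real" where
  "step_factor d s n = (max (real s / real d) (1 - real s / real d)) ^ s *
     (\<Prod>i<d - s. 1 - (real s / real d) * (real n / (real n + real s + real i)))"

text \<open>
  The new factors of \<open>shifted_prod d s\<close> are matched in order with the new factors \<open>d w + n + i\<close> of
  \<open>shifted_prod d 0\<close>.  The first \<open>s\<close> of them have zeros in the right half-plane, at which
  \<open>norm_linear_le\<close> effectively reflects them.
\<close>

lemma shifted_ratio_add:
  assumes "0 \<le> Re w" "0 < d" "s \<le> d" "d \<le> n"
    and le: "cmod (shifted_prod d s n w) \<le> K * cmod (shifted_prod d 0 n w)"
  shows "cmod (shifted_prod d s (n + d) w) \<le> step_factor d s n * K * cmod (shifted_prod d 0 (n + d) w)"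
proof -
  define q where "q = max (real s / real d) (1 - real s / real d)"
  have q0: "0 \<le> q" by (simp add: q_def le_max_iff_disj)
  have n0: "0 < real n" using assms by simp
  define c where "c i = 1 - (real s / real d) * (real n / (real n + real s + real i))" for i
  have sn: "real s * real n / real d \<le> real n" using assms by (simp add: field_simps)
  have sn': "real s \<le> real s * real n / real d" using assms mult_left_mono[of "real d" "real n" "real s"] by (simp add: pos_le_divide_eq)
  let ?D = "\<lambda>i. cmod (of_real (real d) * w + of_real (real n + real i))"
  let ?B = "\<lambda>i. of_real (real d - real s) * w - of_real (real s * real n / real d - real s + real i)"
  let ?T = "\<lambda>i. of_real (real d - real s) * w + of_real (real n + real s + real i - real s * real n / real d)"
  have bottom: "cmod (?B i) \<le> q * ?D i" if "i < s" for i
  proof -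
    have "real d - real s \<le> (1 - real s / real d) * real d" using assms by (simp add: field_simps)
    also have "\<dots> \<le> q * real d" by (intro mult_right_mono) (simp_all add: q_def)
    finally have 1: "real d - real s \<le> q * real d" .
    have "real i - real s \<le> 0" "0 \<le> real s * real i / real d" using that by auto
    then have "real s * real n / real d - real s + real i \<le> real s * real n / real d + real s * real i / real d"
      by linarith
    also have "\<dots> = (real s / real d) * (real n + real i)" by (simp add: distrib_left)
    also have "\<dots> \<le> q * (real n + real i)" by (intro mult_right_mono) (simp_all add: q_def)
    finally have "real s * real n / real d - real s + real i \<le> q * (real n + real i)" .
    then have 2: "\<bar>- (real s * real n / real d - real s + real i)\<bar> \<le> q * (real n + real i)"
      using sn' by linarith
    have "0 \<le> real d - real s" using assms(3) by simp
    from norm_linear_le[OF assms(1) this q0 1 2] show ?thesis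
      by (simp only: of_real_minus add_uminus_conv_diff)
  qed
  have c0: "0 \<le> c i" and top: "cmod (?T i) \<le> c i * ?D (s + i)" for i
  proof -
    have pos: "0 < real n + real s + real i" using n0 by linarith
    have le1: "real n / (real n + real s + real i) \<le> 1" using pos by simp
    have sd: "real s / real d \<le> 1" "0 \<le> real s / real d" using assms by auto
    show "0 \<le> c i"
      using mult_mono[OF sd(1) le1] n0 by (simp add: c_def)
    have "(real s / real d) * (real n / (real n + real s + real i)) * real d \<le> real s"
      using mult_left_mono[OF le1, of "real s"] assms(2) by simp
    then have 1: "real d - real s \<le> c i * real d" by (simp add: c_def left_diff_distrib)
    have "c i * (real n + real (s + i)) = real n + real s + real i - real s * real n / real d"
      using pos by (simp add: c_def left_diff_distrib) (simp add: add.assoc)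
    then have 2: "\<bar>real n + real s + real i - real s * real n / real d\<bar> \<le> c i * (real n + real (s + i))"
      using sn by simp
    show "cmod (?T i) \<le> c i * ?D (s + i)"
      using norm_linear_le[OF assms(1) _ \<open>0 \<le> c i\<close> 1 2] assms(3) by simp
  qed
  have "cmod (\<Prod>i<s. ?B i) \<le> (\<Prod>i<s. q * ?D i)"
    unfolding prod_norm[symmetric] using bottom by (intro prod_mono) auto
  then have b: "cmod (\<Prod>i<s. ?B i) \<le> q ^ s * (\<Prod>i<s. ?D i)" by (simp add: prod.distrib)
  have "cmod (\<Prod>i<d - s. ?T i) \<le> (\<Prod>i<d - s. c i * ?D (s + i))"
    unfolding prod_norm[symmetric] using top by (intro prod_mono) auto
  then have t: "cmod (\<Prod>i<d - s. ?T i) \<le> (\<Prod>i<d - s. c i) * (\<Prod>i<d - s. ?D (s + i))"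
    by (simp add: prod.distrib)
  have P0: "0 \<le> (\<Prod>i<s. ?D i)" "0 \<le> (\<Prod>i<d - s. ?D (s + i))" "0 \<le> (\<Prod>i<d - s. c i)"
    using c0 by (auto intro: prod_nonneg)
  have "(\<Prod>i<d. ?D i) = (\<Prod>i<s. ?D i) * (\<Prod>i<d - s. ?D (s + i))"
  proof -
    have "(\<Prod>i<d. ?D i) = (\<Prod>i\<in>{0..<s}. ?D i) * (\<Prod>i\<in>{s..<d}. ?D i)"
      using assms(3) by (simp add: prod.atLeastLessThan_concat atLeast0LessThan[symmetric] del: of_real_add)
    also have "(\<Prod>i\<in>{s..<d}. ?D i) = (\<Prod>i<d - s. ?D (s + i))"
      by (rule prod.reindex_bij_witness[of _ "\<lambda>i. s + i" "\<lambda>j. j - s"]) auto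
    finally show ?thesis by (simp add: atLeast0LessThan)
  qed
  then have D: "cmod (shifted_prod d 0 (n + d) w) =
      cmod (shifted_prod d 0 n w) * ((\<Prod>i<s. ?D i) * (\<Prod>i<d - s. ?D (s + i)))"
    using shifted_prod_add[of d 0 n w] assms by (simp add: norm_mult prod_norm)
  have "cmod (shifted_prod d s (n + d) w) =
      cmod (\<Prod>i<s. ?B i) * cmod (shifted_prod d s n w) * cmod (\<Prod>i<d - s. ?T i)"
    using shifted_prod_add[of d s n w] assms by (simp only: norm_mult)
  also have "\<dots> \<le> (q ^ s * (\<Prod>i<s. ?D i)) * (K * cmod (shifted_prod d 0 n w)) *
      ((\<Prod>i<d - s. c i) * (\<Prod>i<d - s. ?D (s + i)))"
    using b t le P0 q0 order_trans[OF norm_ge_zero le] by (intro mult_mono) auto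
  also have "\<dots> = step_factor d s n * K * cmod (shifted_prod d 0 (n + d) w)"
    by (simp only: D step_factor_def q_def c_def mult_ac)
  finally show ?thesis .
qed

text \<open>
  The factors may be matched in any order \<open>\<sigma>\<close>.  This matters when the constant terms change sign:
  the best match sorts them by absolute value.
\<close>

lemma shifted_ratio_le_prod:
  assumes "0 \<le> Re w" "s \<le> d" "0 < d" and \<sigma>: "bij_betw \<sigma> {1..<n} {1..<n}"
  shows "cmod (shifted_prod d s n w) \<le>
     (\<Prod>j=1..<n. max (1 - real s / real d) (\<bar>real j + real s - real s * real n / real d\<bar> / real (\<sigma> j)))
     * cmod (shifted_prod d 0 n w)"
proof -
  define c where "c j = max (1 - real s / real d) (\<bar>real j + real s - real s * real n / real d\<bar> / real (\<sigma> j))" for j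
  have "cmod (shifted_prod d s n w) \<le> (\<Prod>j=1..<n. c j * cmod (of_real (real d) * w + of_real (real (\<sigma> j))))"
    unfolding shifted_prod_def prod_norm[symmetric]
  proof (rule prod_mono, safe)
    fix j assume "j \<in> {1..<n}"
    then have sj: "0 < real (\<sigma> j)" using bij_betwE[OF \<sigma>] by force
    have "(1 - real s / real d) * real d \<le> c j * real d"
      by (intro mult_right_mono) (auto simp: c_def)
    then have "real d - real s \<le> c j * real d" using assms(3) by (simp add: left_diff_distrib)
    moreover have "\<bar>real j + real s - real s * real n / real d\<bar> / real (\<sigma> j) \<le> c j"
      by (simp add: c_def)
    moreover have "0 \<le> c j" by (simp add: c_def le_max_iff_disj)
    ultimately show "cmod (of_real (real d - real s) * w + of_real (real j + real s - real s * real n / real d))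
        \<le> c j * cmod (of_real (real d) * w + of_real (real (\<sigma> j)))"
      using assms sj by (intro norm_linear_le) (auto simp: pos_divide_le_eq)
  qed auto
  also have "\<dots> = (\<Prod>j=1..<n. c j) * (\<Prod>j=1..<n. cmod (of_real (real d) * w + of_real (real (\<sigma> j))))"
    by (rule prod.distrib)
  also have "(\<Prod>j=1..<n. cmod (of_real (real d) * w + of_real (real (\<sigma> j)))) =
      (\<Prod>j=1..<n. cmod (of_real (real d) * w + of_real (real j)))"
    by (rule prod.reindex_bij_betw[OF \<sigma>])
  also have "\<dots> = cmod (shifted_prod d 0 n w)"
    by (simp add: shifted_prod_def prod_norm)
  finally show ?thesis by (simp only: c_def)
qed

lemma step_factor_bounds:
  assumes "1 \<le> s" "s < d"
  shows "0 \<le> step_factor d s n" "step_factor d s n \<le> 1 - 1 / real d"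
proof -
  define q where "q = max (real s / real d) (1 - real s / real d)"
  define c where "c i = 1 - (real s / real d) * (real n / (real n + real s + real i))" for i
  have q: "0 \<le> q" "q \<le> 1 - 1 / real d"
    using assms by (auto simp: q_def le_max_iff_disj field_simps)
  have c: "0 \<le> c i \<and> c i \<le> 1" for i
  proof -
    have "0 \<le> real n / (real n + real s + real i)" "real n / (real n + real s + real i) \<le> 1"
      using assms by (auto simp: divide_le_eq_1)
    moreover have "0 \<le> real s / real d" "real s / real d \<le> 1" using assms by auto
    moreover have "0 \<le> 1 - x * y \<and> 1 - x * y \<le> 1" if "0 \<le> x" "x \<le> 1" "0 \<le> y" "y \<le> 1" for x y :: real
      using that by (simp add: mult_le_one)
    ultimately show ?thesis by (simp only: c_def)
  qed
  have P: "0 \<le> (\<Prod>i<d - s. c i)" "(\<Prod>i<d - s. c i) \<le> 1"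
    using c by (auto intro: prod_nonneg prod_le_1)
  have e: "step_factor d s n = q ^ s * (\<Prod>i<d - s. c i)"
    by (simp add: step_factor_def q_def c_def)
  show "0 \<le> step_factor d s n" using q P by (simp add: e)
  have "step_factor d s n \<le> q ^ s * 1" unfolding e using q P by (intro mult_left_mono) auto
  also have "\<dots> \<le> q ^ 1" using q assms
    by (simp only: mult_1_right, intro power_decreasing) (auto intro: order_trans)
  finally show "step_factor d s n \<le> 1 - 1 / real d" using q by simp
qed

text \<open>
  For \<open>d \<le> n < 2 d\<close> every single quotient is at most \<open>d\<close>, which gives the constant; each further
  step by \<open>d\<close> contributes one factor \<open>1 - 1/d\<close>.
\<close>

lemma shifted_ratio_geometric:
  assumes "0 \<le> Re w" "1 \<le> s" "s < d" "d \<le> n"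
  shows "cmod (shifted_prod d s n w) \<le>
     real d ^ (2 * d) * (1 - 1 / real d) ^ (n div d - 1) * cmod (shifted_prod d 0 n w)"
  using assms(4)
proof (induction n rule: less_induct)
  case (less n)
  show ?case
  proof (cases "n < 2 * d")
    case True
    then have nd: "n div d = 1" using less.prems by (intro div_nat_eqI) auto
    have "max (1 - real s / real d) (\<bar>real j + real s - real s * real n / real d\<bar> / real j) \<le> real d"
      if "j \<in> {1..<n}" for j
    proof -
      have j: "1 \<le> real j" "1 \<le> real d" "real s \<le> real d" using that assms by auto
      have "real s * real n \<le> real s * (2 * real d)" using True by (intro mult_left_mono) auto
      then have 1: "real s * real n / real d \<le> 2 * real s" using assms by (simp add: field_simps)
      have 2: "real s \<le> real s * real n / real d" using assms less.prems mult_left_mono[of "real d" "real n" "real s"]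
        by (simp add: pos_le_divide_eq)
      have "real d * 1 \<le> real d * real j" "1 * real j \<le> real d * real j" using j by (intro mult_left_mono mult_right_mono; simp)+
      then have "\<bar>real j + real s - real s * real n / real d\<bar> \<le> real d * real j"
        using 1 2 j by linarith
      then have "\<bar>real j + real s - real s * real n / real d\<bar> / real j \<le> real d"
        using j by (simp add: pos_divide_le_eq)
      moreover have "1 - real s / real d \<le> 1" by simp
      ultimately show ?thesis using j by linarith
    qed
    then have "(\<Prod>j=1..<n. max (1 - real s / real d) (\<bar>real j + real s - real s * real n / real d\<bar> / real j))
        \<le> (\<Prod>j=1..<n. real d)"
      using assms by (intro prod_mono) (auto simp: le_max_iff_disj)
    also have "\<dots> = real d ^ (n - 1)" by simp
    also have "\<dots> \<le> real d ^ (2 * d)" using True assms by (intro power_increasing) auto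
    finally have "(\<Prod>j=1..<n. max (1 - real s / real d) (\<bar>real j + real s - real s * real n / real d\<bar> / real j))
         * cmod (shifted_prod d 0 n w) \<le> real d ^ (2 * d) * cmod (shifted_prod d 0 n w)"
      by (intro mult_right_mono) auto
    with shifted_ratio_le_prod[of w s d "\<lambda>j. j" n] assms nd show ?thesis
      by (simp add: bij_betw_def)
  next
    case False
    define m where "m = n - d"
    have m: "n = m + d" "d \<le> m" "m < n" using False assms by (auto simp: m_def)
    define K where "K = real d ^ (2 * d) * (1 - 1 / real d) ^ (m div d - 1)"
    have K0: "0 \<le> K" using assms by (simp add: K_def)
    have "m div d \<ge> 1" using m(2) assms by (simp add: div_greater_zero_iff Suc_le_eq)
    then have e: "n div d - 1 = Suc (m div d - 1)" using m(1) assms by simp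
    have "cmod (shifted_prod d s n w) \<le> step_factor d s m * K * cmod (shifted_prod d 0 n w)"
      unfolding m(1) using less.IH[OF m(3,2)] assms m(2)
      by (intro shifted_ratio_add) (auto simp: K_def)
    also have "\<dots> \<le> (1 - 1 / real d) * K * cmod (shifted_prod d 0 n w)"
      using step_factor_bounds[OF assms(2,3)] K0 by (intro mult_right_mono) auto
    also have "\<dots> = real d ^ (2 * d) * (1 - 1 / real d) ^ (n div d - 1) * cmod (shifted_prod d 0 n w)"
      unfolding e K_def power_Suc by (simp only: mult_ac)
    finally show ?thesis .
  qed
qed

lemma shifted_prod_0: "shifted_prod d 0 n w = hyp_prod d 0 n w"
  by (simp add: shifted_prod_def hyp_prod_def)

lemma root_Re_greater:
  assumes "0 < d" "poly (katzman_poly d n) z = 0"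
    and dom: "\<And>w. 0 \<le> Re w \<Longrightarrow>
      (\<Sum>s=1..<d. real (n choose s) * cmod (shifted_prod d s n w)) < cmod (shifted_prod d 0 n w)"
  shows "- (real n / real d) < Re z"
proof (rule ccontr)
  assume "\<not> - (real n / real d) < Re z"
  moreover define w where "w = - z - of_real (real n / real d)"
  ultimately have "0 \<le> Re w" by simp
  from dom[OF this] have "(\<Sum>s=1..<d. real (n choose s) * cmod (hyp_prod d s n z)) < cmod (hyp_prod d 0 n z)"
    using norm_hyp_prod_eq_shifted[OF assms(1), of _ n w] by (simp add: w_def)
  then show False using katzman_poly_nonzero[of d n z] assms(1,2) by simp
qed

lemma geometric_beats_power:
  assumes "2 \<le> d"
  shows "\<exists>k0. \<forall>k\<ge>k0. C * real (k + 2) ^ d * (1 - 1 / real d) ^ k < 1"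
proof -
  define q where "q = 1 - 1 / real d"
  have q: "0 < q" "q < 1" using assms by (auto simp: q_def field_simps)
  have "(\<lambda>k. C * real (k + 2) ^ d * q ^ k) \<longlonglongrightarrow> 0"
    using q by real_asymp
  then have "eventually (\<lambda>k. C * real (k + 2) ^ d * q ^ k < 1) sequentially"
    by (rule order_tendstoD) simp
  then show ?thesis by (simp add: eventually_sequentially q_def)
qed

text \<open>
  The geometric decay of the quotients beats the binomial coefficients, which are at most \<open>n^d\<close>,
  uniformly in \<open>w\<close>.
\<close>

lemma eventually_dominated_left:
  assumes "2 \<le> d"
  shows "\<exists>N. \<forall>n\<ge>N. \<forall>w. 0 \<le> Re w \<longrightarrow>
    (\<Sum>s=1..<d. real (n choose s) * cmod (shifted_prod d s n w)) < cmod (shifted_prod d 0 n w)"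
proof -
  define C where "C = real d * real d ^ d * real d ^ (2 * d)"
  obtain k0 where k0: "C * real (k + 2) ^ d * (1 - 1 / real d) ^ k < 1" if "k \<ge> k0" for k
    using geometric_beats_power[OF assms, of C] by blast
  have "(\<Sum>s=1..<d. real (n choose s) * cmod (shifted_prod d s n w)) < cmod (shifted_prod d 0 n w)"
    if n: "d * (k0 + 1) \<le> n" and w: "0 \<le> Re w" for n w
  proof -
    define k where "k = n div d - 1"
    have "k0 + 1 \<le> n div d" using div_le_mono[OF n, of d] assms by simp
    then have k: "k0 \<le> k" "n div d = k + 1" by (auto simp: k_def)
    have "n = d * (n div d) + n mod d" by simp
    also have "\<dots> \<le> d * (k + 2)" using k(2) mod_less_divisor[of d n] assms by (simp add: less_imp_le)
    finally have nk: "n \<le> d * (k + 2)" .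
    have dn: "d \<le> n" using n mult_le_mono2[of 1 "k0 + 1" d] by simp
    define M where "M = cmod (shifted_prod d 0 n w)"
    have M: "0 < M" using hyp_prod_pos[OF w] by (simp add: M_def shifted_prod_0)
    have q: "0 \<le> 1 - 1 / real d" using assms by simp
    have "real (n choose s) * cmod (shifted_prod d s n w)
        \<le> (real d * real (k + 2)) ^ d * (real d ^ (2 * d) * (1 - 1 / real d) ^ k * M)" if s: "s \<in> {1..<d}" for s
    proof (rule mult_mono)
      have "n choose s \<le> n ^ s" using s dn by (intro binomial_le_pow) auto
      also have "\<dots> \<le> n ^ d" using s dn by (intro power_increasing) auto
      also have "\<dots> \<le> (d * (k + 2)) ^ d" by (rule power_mono[OF nk]) simp
      finally show "real (n choose s) \<le> (real d * real (k + 2)) ^ d"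
        by (metis of_nat_le_iff of_nat_mult of_nat_power)
      show "cmod (shifted_prod d s n w) \<le> real d ^ (2 * d) * (1 - 1 / real d) ^ k * M"
        using shifted_ratio_geometric[OF w _ _ dn, of s] s by (simp add: M_def k_def)
    qed auto
    then have "(\<Sum>s=1..<d. real (n choose s) * cmod (shifted_prod d s n w))
       \<le> (\<Sum>s=1..<d. (real d * real (k + 2)) ^ d * (real d ^ (2 * d) * (1 - 1 / real d) ^ k * M))"
      by (rule sum_mono)
    also have "\<dots> = real (d - 1) * ((real d * real (k + 2)) ^ d * (real d ^ (2 * d) * (1 - 1 / real d) ^ k * M))"
      by simp
    also have "\<dots> \<le> real d * ((real d * real (k + 2)) ^ d * (real d ^ (2 * d) * (1 - 1 / real d) ^ k * M))"
      using q M by (intro mult_right_mono mult_nonneg_nonneg) auto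
    also have "\<dots> = (C * real (k + 2) ^ d * (1 - 1 / real d) ^ k) * M"
      by (simp only: C_def power_mult_distrib mult_ac)
    also have "\<dots> < 1 * M" using k0[OF k(1)] M by (rule mult_strict_right_mono)
    finally show ?thesis by (simp add: M_def)
  qed
  then show ?thesis by blast
qed


section \<open>Hypersimplices with d = 3: right of the imaginary axis\<close>

lemma quadratic_nonneg:
  fixes a b c v :: real
  assumes "0 < a" "b\<^sup>2 \<le> 4 * a * c"
  shows "0 \<le> a * v\<^sup>2 + b * v + c"
proof -
  have "4 * a * (a * v\<^sup>2 + b * v + c) = (2 * a * v + b)\<^sup>2 + (4 * a * c - b\<^sup>2)"
    by algebra
  also have "\<dots> \<ge> 0" using assms by simp
  finally show ?thesis using assms(1) by (simp add: zero_le_mult_iff)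
qed

lemma norm_mult_le_of_squares:
  fixes a b c e :: complex
  assumes "(cmod a)\<^sup>2 * (cmod b)\<^sup>2 \<le> k\<^sup>2 * ((cmod c)\<^sup>2 * (cmod e)\<^sup>2)" "0 \<le> k"
  shows "cmod a * cmod b \<le> k * (cmod c * cmod e)"
proof (rule power2_le_imp_le)
  show "(cmod a * cmod b)\<^sup>2 \<le> (k * (cmod c * cmod e))\<^sup>2"
    using assms(1) by (simp add: power_mult_distrib)
qed (use assms(2) in simp)

text \<open>
  Comparing one factor at a time loses too much on the imaginary axis: for instance \<open>2 z + 3\<close> is
  large relative to \<open>3 z + 4\<close> only near \<open>0\<close>, where \<open>2 z\<close> is small.  The constants are slightly above
  the suprema of the quotients of the pairs, which are attained on the imaginary axis.  In terms of
  \<open>x = Re z\<close> and \<open>v = (Im z)\<^sup>2\<close>, the difference of the squares has nonnegative coefficients except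
  for the coefficient of \<open>v\<close>, and the part depending on \<open>v\<close> alone has negative discriminant.
\<close>

lemma pair_bounds:
  fixes z :: complex
  assumes "0 \<le> Re z"
  shows "cmod (2 * z) * cmod (2 * z + 3) \<le> 4594 / 10000 * (cmod (3 * z + 1) * cmod (3 * z + 4))" (is ?A)
    and "cmod (2 * z + 1) * cmod (2 * z + 5) \<le> 5736 / 10000 * (cmod (3 * z + 2) * cmod (3 * z + 5))" (is ?B)
    and "cmod (z - 1) * cmod z \<le> 1273 / 10000 * (cmod (3 * z + 1) * cmod (3 * z + 2))" (is ?C)
proof -
  define x v where "x = Re z" and "v = (Im z)\<^sup>2"
  have x: "0 \<le> x" and v: "0 \<le> v" using assms by (simp_all add: x_def v_def)
  have sq: "(cmod (of_real a * z + of_real p))\<^sup>2 = (a * x + p)\<^sup>2 + a\<^sup>2 * v" for a p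
    by (simp add: cmod_power2 x_def v_def power_mult_distrib)
  have sq2: "(cmod (2 * z + numeral p))\<^sup>2 = (2 * x + numeral p)\<^sup>2 + 4 * v"
    "(cmod (2 * z + 1))\<^sup>2 = (2 * x + 1)\<^sup>2 + 4 * v" "(cmod (2 * z))\<^sup>2 = (2 * x)\<^sup>2 + 4 * v"
    "(cmod (3 * z + numeral p))\<^sup>2 = (3 * x + numeral p)\<^sup>2 + 9 * v"
    "(cmod (3 * z + 1))\<^sup>2 = (3 * x + 1)\<^sup>2 + 9 * v"
    "(cmod z)\<^sup>2 = x\<^sup>2 + v" "(cmod (z - 1))\<^sup>2 = (x - 1)\<^sup>2 + v" for p
    using sq[of 2 "numeral p"] sq[of 2 1] sq[of 2 0] sq[of 3 "numeral p"] sq[of 3 1] sq[of 1 0] sq[of 1 "-1"]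
    by simp_all
  show ?A
  proof (rule norm_mult_le_of_squares)
    have "211 * (((3 * x+1)\<^sup>2 + 9 * v) * ((3 * x+4)\<^sup>2 + 9 * v)) - 1000 * (((2 * x)\<^sup>2 + 4 * v) * ((2 * x+3)\<^sup>2 + 4 * v))
       = (1091 * v\<^sup>2 + (-3717) * v + 3376) + 25320 * x + 8970 * (x * v) + 26667 * x\<^sup>2 + 2182 * (x\<^sup>2 * v) + 8970 * x^3 + 1091 * x^4"
      by algebra
    also have "\<dots> \<ge> 0" using x v by (intro add_nonneg_nonneg quadratic_nonneg) auto
    finally have "((2 * x)\<^sup>2 + 4 * v) * ((2 * x+3)\<^sup>2 + 4 * v) \<le> 211 / 1000 * (((3 * x+1)\<^sup>2 + 9 * v) * ((3 * x+4)\<^sup>2 + 9 * v))"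
      by simp
    also have "\<dots> \<le> (4594 / 10000)\<^sup>2 * (((3 * x+1)\<^sup>2 + 9 * v) * ((3 * x+4)\<^sup>2 + 9 * v))"
      using v by (intro mult_right_mono) (auto simp: power2_eq_square)
    finally show "(cmod (2 * z))\<^sup>2 * (cmod (2 * z + 3))\<^sup>2 \<le> (4594 / 10000)\<^sup>2 * ((cmod (3 * z + 1))\<^sup>2 * (cmod (3 * z + 4))\<^sup>2)"
      by (simp only: sq2)
  qed simp
  show ?B
  proof (rule norm_mult_le_of_squares)
    have "329 * (((3 * x+2)\<^sup>2 + 9 * v) * ((3 * x+5)\<^sup>2 + 9 * v)) - 1000 * (((2 * x+1)\<^sup>2 + 4 * v) * ((2 * x+5)\<^sup>2 + 4 * v))
       = (10649 * v\<^sup>2 + (-18131) * v + 7900) + 18180 * x + 28362 * (x * v) + 20309 * x\<^sup>2 + 21298 * (x\<^sup>2 * v) + 28362 * x^3 + 10649 * x^4"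
      by algebra
    also have "\<dots> \<ge> 0" using x v by (intro add_nonneg_nonneg quadratic_nonneg) auto
    finally have "((2 * x+1)\<^sup>2 + 4 * v) * ((2 * x+5)\<^sup>2 + 4 * v) \<le> 329 / 1000 * (((3 * x+2)\<^sup>2 + 9 * v) * ((3 * x+5)\<^sup>2 + 9 * v))"
      by simp
    also have "\<dots> \<le> (5736 / 10000)\<^sup>2 * (((3 * x+2)\<^sup>2 + 9 * v) * ((3 * x+5)\<^sup>2 + 9 * v))"
      using v by (intro mult_right_mono) (auto simp: power2_eq_square)
    finally show "(cmod (2 * z + 1))\<^sup>2 * (cmod (2 * z + 5))\<^sup>2 \<le> (5736 / 10000)\<^sup>2 * ((cmod (3 * z + 2))\<^sup>2 * (cmod (3 * z + 5))\<^sup>2)"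
      by (simp only: sq2)
  qed simp
  show ?C
  proof (rule norm_mult_le_of_squares)
    have "162 * (((3 * x+1)\<^sup>2 + 9 * v) * ((3 * x+2)\<^sup>2 + 9 * v)) - 10000 * ((x\<^sup>2 + v) * ((x+1)\<^sup>2 + v))
       = (3122 * v\<^sup>2 + (-2710) * v + 648) + 5832 * x + 6244 * (x * v) + 8954 * x\<^sup>2 + 6244 * (x\<^sup>2 * v) + 6244 * x^3 + 3122 * x^4"
      by algebra
    also have "\<dots> \<ge> 0" using x v by (intro add_nonneg_nonneg quadratic_nonneg) auto
    finally have *: "(x\<^sup>2 + v) * ((x+1)\<^sup>2 + v) \<le> 162 / 10000 * (((3 * x+1)\<^sup>2 + 9 * v) * ((3 * x+2)\<^sup>2 + 9 * v))"
      by simp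
    have "(x - 1)\<^sup>2 \<le> (x + 1)\<^sup>2" using x by (simp add: power2_eq_square algebra_simps)
    then have "((x-1)\<^sup>2 + v) * (x\<^sup>2 + v) \<le> (x\<^sup>2 + v) * ((x+1)\<^sup>2 + v)"
      using v by (subst mult.commute) (intro mult_left_mono, auto)
    also note *
    also have "162 / 10000 * (((3 * x+1)\<^sup>2 + 9 * v) * ((3 * x+2)\<^sup>2 + 9 * v)) \<le> (1273 / 10000)\<^sup>2 * (((3 * x+1)\<^sup>2 + 9 * v) * ((3 * x+2)\<^sup>2 + 9 * v))"
      using v by (intro mult_right_mono) (auto simp: power2_eq_square)
    finally show "(cmod (z - 1))\<^sup>2 * (cmod z)\<^sup>2 \<le> (1273 / 10000)\<^sup>2 * ((cmod (3 * z + 1))\<^sup>2 * (cmod (3 * z + 2))\<^sup>2)"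
      by (simp only: sq2)
  qed simp
qed

lemma atLeastLessThan_1_numerals:
  "{Suc 0..<3} = {1, 2}" "{Suc 0..<6} = {1, 2, 3, 4, 5}"
  "{Suc 0..<7} = {1, 2, 3, 4, 5, 6}" "{Suc 0..<8} = {1, 2, 3, 4, 5, 6, 7}"
  by auto

text \<open>
  The constants add up to less than \<open>1\<close>, but only just.  Two factors of each numerator are
  exact multiples of \<open>3 z + 3\<close> and \<open>3 z + 6\<close>, so that nothing is lost on them; the others are
  compared in pairs where single comparisons would lose too much.
\<close>

lemma right_base_7:
  assumes "0 \<le> Re z"
  shows "real (7 choose 1) * cmod (hyp_prod 3 1 7 z) \<le> 82 / 100 * cmod (hyp_prod 3 0 7 z)" (is ?A)
    and "real (7 choose 2) * cmod (hyp_prod 3 2 7 z) \<le> 179 / 1000 * cmod (hyp_prod 3 0 7 z)" (is ?B)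
proof -
  define N where "N p = cmod (3 * z + of_nat p)" for p
  have N0: "0 \<le> N p" for p by (simp add: N_def)
  note pb = pair_bounds[OF assms]
  have h0: "cmod (hyp_prod 3 0 7 z) = N 1 * N 2 * N 3 * N 4 * N 5 * N 6"
    by (simp add: hyp_prod_def atLeastLessThan_1_numerals norm_mult N_def mult_ac del: prod.op_ivl_Suc)
  have lin: "cmod (of_real a * z + of_real p) \<le> c * N q" if "0 \<le> a" "0 \<le> c" "a \<le> c * 3" "\<bar>p\<bar> \<le> c * real q" for a p c q
    using norm_linear_le[OF assms that] by (simp add: N_def)
  have "hyp_prod 3 1 7 z = (2 * z) * (2 * z + 1) * (2 * z + 2) * (2 * z + 3) * (2 * z + 4) * (2 * z + 5)"
    by (simp add: hyp_prod_def atLeastLessThan_1_numerals algebra_simps del: prod.op_ivl_Suc)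
  then have "cmod (hyp_prod 3 1 7 z) = (cmod (2 * z) * cmod (2 * z + 3)) * (cmod (2 * z + 1) * cmod (2 * z + 5)) *
      (cmod (2 * z + 2) * cmod (2 * z + 4))"
    by (simp only: norm_mult mult_ac)
  also have "\<dots> \<le> (4594 / 10000 * (N 1 * N 4)) * (5736 / 10000 * (N 2 * N 5)) * ((2 / 3 * N 3) * (2 / 3 * N 6))"
  proof -
    have 1: "cmod (2 * z) * cmod (2 * z + 3) \<le> 4594 / 10000 * (N 1 * N 4)"
      using pb(1) by (simp add: N_def)
    have 2: "cmod (2 * z + 1) * cmod (2 * z + 5) \<le> 5736 / 10000 * (N 2 * N 5)"
      using pb(2) by (simp add: N_def)
    have 3: "cmod (2 * z + 2) \<le> 2 / 3 * N 3" using lin[of 2 "2/3" 2 3] by simp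
    have 4: "cmod (2 * z + 4) \<le> 2 / 3 * N 6" using lin[of 2 "2/3" 4 6] by simp
    show ?thesis
      by (rule mult_mono[OF mult_mono[OF 1 2] mult_mono[OF 3 4]]) (simp_all add: N0)
  qed
  finally have "real (7 choose 1) * cmod (hyp_prod 3 1 7 z)
    \<le> (7 * (4594 / 10000) * (5736 / 10000) * (4 / 9)) * cmod (hyp_prod 3 0 7 z)"
    by (simp add: h0 mult_ac)
  also have "\<dots> \<le> 82 / 100 * cmod (hyp_prod 3 0 7 z)"
    by (intro mult_right_mono) auto
  finally show ?A .
  have "hyp_prod 3 2 7 z = (z - 1) * z * (z + 1) * (z + 2) * (z + 3) * (z + 4)"
    by (simp add: hyp_prod_def atLeastLessThan_1_numerals algebra_simps del: prod.op_ivl_Suc)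
  then have "cmod (hyp_prod 3 2 7 z) = (cmod (z - 1) * cmod z) * (cmod (z + 1) * cmod (z + 2)) *
      (cmod (z + 3) * cmod (z + 4))"
    by (simp only: norm_mult mult_ac)
  also have "\<dots> \<le> (1273 / 10000 * (N 1 * N 2)) * ((1 / 3 * N 3) * (1 / 3 * N 6)) * ((3 / 4 * N 4) * (4 / 5 * N 5))"
  proof -
    have 1: "cmod (z - 1) * cmod z \<le> 1273 / 10000 * (N 1 * N 2)"
      using pb(3) by (simp add: N_def)
    have 2: "cmod (z + 1) \<le> 1 / 3 * N 3" using lin[of 1 "1/3" 1 3] by simp
    have 3: "cmod (z + 2) \<le> 1 / 3 * N 6" using lin[of 1 "1/3" 2 6] by simp
    have 4: "cmod (z + 3) \<le> 3 / 4 * N 4" using lin[of 1 "3/4" 3 4] by simp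
    have 5: "cmod (z + 4) \<le> 4 / 5 * N 5" using lin[of 1 "4/5" 4 5] by simp
    show ?thesis
      by (rule mult_mono[OF mult_mono[OF 1 mult_mono[OF 2 3]] mult_mono[OF 4 5]]) (simp_all add: N0)
  qed
  finally have "real (7 choose 2) * cmod (hyp_prod 3 2 7 z)
    \<le> (21 * (1273 / 10000) * (1 / 9) * (3 / 5)) * cmod (hyp_prod 3 0 7 z)"
    by (simp add: h0 mult_ac choose_two)
  also have "\<dots> \<le> 179 / 1000 * cmod (hyp_prod 3 0 7 z)"
    by (intro mult_right_mono) auto
  finally show ?B .
qed

lemma root_d3_Re_less_0:
  assumes "7 \<le> n" "poly (katzman_poly 3 n) z = 0"
  shows "Re z < 0"
proof (rule ccontr)
  assume "\<not> Re z < 0"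
  then have z: "0 \<le> Re z" by simp
  have "real (n choose 1) * cmod (hyp_prod 3 1 n z) \<le> 82 / 100 * cmod (hyp_prod 3 0 n z)
      \<and> real (n choose 2) * cmod (hyp_prod 3 2 n z) \<le> 179 / 1000 * cmod (hyp_prod 3 0 n z)"
    using assms(1)
  proof (induction n rule: nat_induct_at_least)
    case base show ?case using right_base_7[OF z] by blast
  next
    case (Suc n)
    then show ?case
      by (intro conjI weighted_ratio_Suc[OF z]) simp_all
  qed
  then have "(\<Sum>s=1..<3. real (n choose s) * cmod (hyp_prod 3 s n z)) \<le> 999 / 1000 * cmod (hyp_prod 3 0 n z)"
    by (simp add: atLeastLessThan_1_numerals del: sum.op_ivl_Suc)
  also have "\<dots> < cmod (hyp_prod 3 0 n z)" using hyp_prod_pos[OF z, of 3 n] by simp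
  finally show False using katzman_poly_nonzero[of 3 n z] assms(2) by simp
qed

text \<open>
  Here \<open>n = 2 d\<close>, and the Ehrhart polynomial is symmetric about \<open>- n / 6 = - 1\<close>.  In \<open>t = z + 1\<close> it is
  a multiple of \<open>t (11 t^4 + 5 t\<^sup>2 + 4)\<close>, whose roots lie in the open unit disc.
\<close>

lemma roots_d3_n6:
  assumes "poly (katzman_poly 3 6) z = 0"
  shows "-2 < Re z" "Re z < 0"
proof -
  define t where "t = z + 1"
  have z: "z = t - 1" by (simp add: t_def)
  have s3: "{..<3::nat} = {0, 1, 2}" by auto
  have "120 * poly (katzman_poly 3 6) z = 6 * t * (11 * t ^ 4 + 5 * t ^ 2 + 4)"
  proof -
    have h: "hyp_prod 3 0 6 z = (3*t-2)*(3*t-1)*(3*t)*(3*t+1)*(3*t+2)"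
      "hyp_prod 3 1 6 z = (2*t-2)*(2*t-1)*(2*t)*(2*t+1)*(2*t+2)"
      "hyp_prod 3 2 6 z = (t-2)*(t-1)*t*(t+1)*(t+2)"
      by (simp_all add: hyp_prod_def atLeastLessThan_1_numerals z mult_ac algebra_simps del: prod.op_ivl_Suc)
    have "120 * poly (katzman_poly 3 6) z = hyp_prod 3 0 6 z - 6 * hyp_prod 3 1 6 z + 15 * hyp_prod 3 2 6 z"
      by (simp add: poly_katzman_poly s3 choose_two fact_numeral algebra_simps)
    also have "\<dots> = 6 * t * (11 * t ^ 4 + 5 * t ^ 2 + 4)"
      unfolding h by algebra
    finally show ?thesis .
  qed
  then have "t = 0 \<or> 11 * t ^ 4 + 5 * t ^ 2 + 4 = 0" using assms by simp
  then have "cmod t < 1"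
  proof
    assume "11 * t ^ 4 + 5 * t ^ 2 + 4 = 0"
    then have "11 * t ^ 4 = - (5 * t ^ 2 + 4)" by (simp only: eq_neg_iff_add_eq_0 add.assoc)
    then have "cmod (11 * t ^ 4) = cmod (- (5 * t ^ 2 + 4))" by (rule arg_cong)
    then have "11 * cmod t ^ 4 = cmod (5 * t ^ 2 + 4)"
      by (simp only: norm_minus_cancel norm_mult norm_numeral norm_power)
    also have "\<dots> \<le> 5 * cmod t ^ 2 + 4"
      using norm_triangle_ineq[of "5 * t ^ 2" 4] by (simp add: norm_mult norm_power)
    finally have le: "11 * cmod t ^ 4 \<le> 5 * cmod t ^ 2 + 4" .
    show ?thesis
    proof (rule ccontr)
      assume "\<not> cmod t < 1"
      then have "1 \<le> cmod t ^ 2" "cmod t ^ 2 \<le> cmod t ^ 4" by (simp_all add: power_increasing one_le_power)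
      then show False using le by linarith
    qed
  qed simp
  then have "\<bar>Re t\<bar> < 1" using abs_Re_le_cmod[of t] by linarith
  then show "-2 < Re z" "Re z < 0" by (auto simp: z)
qed

section \<open>Hypersimplices with d = 3: left of the strip\<close>

lemma real_choose_2: "real (n choose 2) = real n * (real n - 1) / 2"
  by (induction n) (simp_all add: numeral_2_eq_2 field_simps)

lemma shifted_ratio_base:
  assumes "0 \<le> Re w" "s \<le> d" "0 < d" "bij_betw \<sigma> {1..<n} {1..<n}"
    "real (n choose s) * (\<Prod>j=1..<n. max (1 - real s / real d) (\<bar>real j + real s - real s * real n / real d\<bar> / real (\<sigma> j))) \<le> K"
  shows "real (n choose s) * cmod (shifted_prod d s n w) \<le> K * cmod (shifted_prod d 0 n w)"
  using mult_left_mono[OF shifted_ratio_le_prod[OF assms(1-4)], of "real (n choose s)"]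
    mult_right_mono[OF assms(5) norm_ge_zero[of "shifted_prod d 0 n w"]]
  by (simp add: mult.assoc)

text \<open>
  These two bounds add up to more than \<open>1\<close>; they serve as the starting point for \<open>n = 9\<close>.
\<close>

lemma left_base_6:
  assumes "0 \<le> Re w"
  shows "real (6 choose 1) * cmod (shifted_prod 3 1 6 w) \<le> 16 / 15 * cmod (shifted_prod 3 0 6 w)"
    and "real (6 choose 2) * cmod (shifted_prod 3 2 6 w) \<le> 1 / 2 * cmod (shifted_prod 3 0 6 w)"
  by (rule shifted_ratio_base[OF assms, where \<sigma> = id];
      simp add: atLeastLessThan_1_numerals real_choose_2 max_def abs_if del: prod.op_ivl_Suc)+

lemma left_base_7:
  assumes "0 \<le> Re w"
  shows "real (7 choose 1) * cmod (shifted_prod 3 1 7 w) \<le> 4 / 5 * cmod (shifted_prod 3 0 7 w)"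
    and "real (7 choose 2) * cmod (shifted_prod 3 2 7 w) \<le> 3 / 20 * cmod (shifted_prod 3 0 7 w)"
proof -
  show "real (7 choose 1) * cmod (shifted_prod 3 1 7 w) \<le> 4 / 5 * cmod (shifted_prod 3 0 7 w)"
    by (rule shifted_ratio_base[OF assms, where \<sigma> = id])
       (simp_all add: atLeastLessThan_1_numerals max_def abs_if del: prod.op_ivl_Suc)
  \<comment> \<open>the constant terms \<open>j - 8/3\<close>, sorted by absolute value, are those for \<open>j = 3, 2, 4, 1, 5, 6\<close>\<close>
  define \<sigma> :: "nat \<Rightarrow> nat" where "\<sigma> = id(1 := 4, 3 := 1, 4 := 3)"
  have "bij_betw \<sigma> {1..<7} {1..<7}"
    by (simp add: bij_betw_def inj_on_def \<sigma>_def atLeastLessThan_1_numerals) auto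
  then show "real (7 choose 2) * cmod (shifted_prod 3 2 7 w) \<le> 3 / 20 * cmod (shifted_prod 3 0 7 w)"
    by (rule shifted_ratio_base[OF assms, rotated 2])
       (simp_all add: atLeastLessThan_1_numerals real_choose_2 max_def abs_if \<sigma>_def del: prod.op_ivl_Suc)
qed

lemma left_base_8:
  assumes "0 \<le> Re w"
  shows "real (8 choose 1) * cmod (shifted_prod 3 1 8 w) \<le> 3 / 5 * cmod (shifted_prod 3 0 8 w)"
    and "real (8 choose 2) * cmod (shifted_prod 3 2 8 w) \<le> 19 / 50 * cmod (shifted_prod 3 0 8 w)"
  by (rule shifted_ratio_base[OF assms, where \<sigma> = id];
      simp add: atLeastLessThan_1_numerals real_choose_2 max_def abs_if del: prod.op_ivl_Suc)+

text \<open>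
  Both the growth of the binomial coefficients and the step factors are largest at \<open>n = 6\<close>, where
  their products are \<open>15/28\<close> for \<open>s = 1\<close> and \<open>8/15\<close> for \<open>s = 2\<close>.
\<close>

lemma weighted_ratio_add_3:
  assumes "0 \<le> Re w" "6 \<le> n" "s \<in> {1, 2}" "0 \<le> K"
    and le: "real (n choose s) * cmod (shifted_prod 3 s n w) \<le> K * cmod (shifted_prod 3 0 n w)"
  shows "real ((n + 3) choose s) * cmod (shifted_prod 3 s (n + 3) w)
      \<le> 11 / 20 * K * cmod (shifted_prod 3 0 (n + 3) w)"
proof -
  define x where "x = real n"
  have x: "6 \<le> x" using assms by (simp add: x_def)
  have c0: "0 < real (n choose s)" using assms by (auto simp: zero_less_binomial_iff)
  have step: "real ((n + 3) choose s) * step_factor 3 s n \<le> 11 / 20 * real (n choose s)"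
    using assms(3)
  proof safe
    have f: "step_factor 3 1 n = 2 / 3 * ((1 - 1 / 3 * (x / (x + 1))) * (1 - 1 / 3 * (x / (x + 2))))"
      by (simp add: step_factor_def x_def numeral_2_eq_2 max_def)
    have a: "1 - 1 / 3 * (x / (x + 1)) \<le> 5 / 7" "1 - 1 / 3 * (x / (x + 2)) \<le> 3 / 4"
      "0 \<le> 1 - 1 / 3 * (x / (x + 1))" "0 \<le> 1 - 1 / 3 * (x / (x + 2))" using x by (simp_all add: field_simps)
    have "(x + 3) * step_factor 3 1 n \<le> (3 / 2 * x) * (2 / 3 * (5 / 7 * (3 / 4)))"
      unfolding f using a x by (intro mult_mono mult_nonneg_nonneg) auto
    also have "\<dots> \<le> 11 / 20 * x" using x by simp
    finally show "real ((n + 3) choose 1) * step_factor 3 1 n \<le> 11 / 20 * real (n choose 1)"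
      by (simp add: x_def add_ac)
  next
    have f: "step_factor 3 2 n = 4 / 9 * (1 - 2 / 3 * (x / (x + 2)))"
      by (simp add: step_factor_def x_def max_def power2_eq_square)
    have a: "1 - 2 / 3 * (x / (x + 2)) \<le> 1 / 2" "0 \<le> 1 - 2 / 3 * (x / (x + 2))"
      using x by (simp_all add: field_simps)
    have "((x + 3) * (x + 2)) * step_factor 3 2 n \<le> ((3 / 2 * x) * (8 / 5 * (x - 1))) * (4 / 9 * (1 / 2))"
      unfolding f using a x by (intro mult_mono mult_nonneg_nonneg) auto
    also have "\<dots> \<le> 11 / 20 * (x * (x - 1))" using x by simp
    finally show "real ((n + 3) choose 2) * step_factor 3 2 n \<le> 11 / 20 * real (n choose 2)"
      by (simp add: real_choose_2 x_def add_ac mult_ac)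
  qed
  define M where "M = cmod (shifted_prod 3 0 (n + 3) w)"
  have "cmod (shifted_prod 3 s n w) \<le> (K / real (n choose s)) * cmod (shifted_prod 3 0 n w)"
    using le c0 by (simp add: field_simps)
  from shifted_ratio_add[OF assms(1) _ _ _ this]
  have "cmod (shifted_prod 3 s (n + 3) w) \<le> step_factor 3 s n * (K / real (n choose s)) * M"
    using assms by (auto simp: M_def)
  then have "real ((n + 3) choose s) * cmod (shifted_prod 3 s (n + 3) w)
      \<le> real ((n + 3) choose s) * (step_factor 3 s n * (K / real (n choose s)) * M)"
    by (intro mult_left_mono) auto
  also have "\<dots> = (real ((n + 3) choose s) * step_factor 3 s n) * (K / real (n choose s) * M)"
    by (simp only: mult_ac)
  also have "\<dots> \<le> (11 / 20 * real (n choose s)) * (K / real (n choose s) * M)"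
    using step assms(4) by (intro mult_right_mono) (auto simp: M_def)
  also have "\<dots> = 11 / 20 * K * M" using c0 by simp
  finally show ?thesis by (simp add: M_def)
qed

lemma dominated_left_d3:
  assumes w: "0 \<le> Re w" and n: "7 \<le> n"
  shows "(\<Sum>s=1..<3. real (n choose s) * cmod (shifted_prod 3 s n w)) < cmod (shifted_prod 3 0 n w)"
proof -
  let ?P = "\<lambda>n s K. real (n choose s) * cmod (shifted_prod 3 s n w) \<le> K * cmod (shifted_prod 3 0 n w)"
  have "\<exists>K L. 0 \<le> K \<and> 0 \<le> L \<and> K + L < 1 \<and> ?P n 1 K \<and> ?P n 2 L"
    using n
  proof (induction n rule: less_induct)
    case (less n)
    consider "n = 7" | "n = 8" | "n = 9" | "10 \<le> n" using less.prems by linarith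
    then show ?case
    proof cases
      case 1
      then show ?thesis using left_base_7[OF w] by (intro exI[of _ "4/5"] exI[of _ "3/20"]) auto
    next
      case 2
      then show ?thesis using left_base_8[OF w] by (intro exI[of _ "3/5"] exI[of _ "19/50"]) auto
    next
      case 3
      have "?P (6 + 3) 1 (11/20 * (16/15))" "?P (6 + 3) 2 (11/20 * (1/2))"
        using left_base_6[OF w] by (intro weighted_ratio_add_3[OF w]; simp)+
      then show ?thesis unfolding 3
        by (intro exI[of _ "11/20 * (16/15)"] exI[of _ "11/20 * (1/2)"]) simp
    next
      case 4
      define m where "m = n - 3"
      have m: "n = m + 3" "m < n" "7 \<le> m" using 4 by (auto simp: m_def)
      obtain K L where KL: "0 \<le> K" "0 \<le> L" "K + L < 1" "?P m 1 K" "?P m 2 L"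
        using less.IH[OF m(2,3)] by blast
      have "?P (m + 3) 1 (11/20 * K)" "?P (m + 3) 2 (11/20 * L)"
        using KL m by (intro weighted_ratio_add_3[OF w]; simp)+
      then show ?thesis unfolding m(1) using KL
        by (intro exI[of _ "11/20 * K"] exI[of _ "11/20 * L"]) auto
    qed
  qed
  then obtain K L where KL: "K + L < 1" "?P n 1 K" "?P n 2 L" by blast
  have "(\<Sum>s=1..<3. real (n choose s) * cmod (shifted_prod 3 s n w)) \<le> (K + L) * cmod (shifted_prod 3 0 n w)"
    using KL by (simp add: atLeastLessThan_1_numerals distrib_right del: sum.op_ivl_Suc)
  also have "\<dots> < 1 * cmod (shifted_prod 3 0 n w)"
    using KL(1) hyp_prod_pos[OF w] by (intro mult_strict_right_mono) (auto simp: shifted_prod_0)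
  finally show ?thesis by simp
qed


section \<open>Location of the roots\<close>

theorem theorem0p2:
  shows "(\<forall>n::nat. n \<ge> 6 \<longrightarrow>
            (\<forall>a::complex. poly (ehrhart_poly n (hypersimplex 3 n)) a = 0 \<longrightarrow>
               - (real n / 3) < Re a \<and> Re a < 0))
       \<and> (\<forall>d::nat. d \<ge> 4 \<longrightarrow>
            (\<exists>N::nat. \<forall>n::nat. n \<ge> N \<and> n \<ge> 2 * d \<longrightarrow>
               (\<forall>a::complex. poly (ehrhart_poly n (hypersimplex d n)) a = 0 \<longrightarrow>
                  - (real n / real d) < Re a \<and> Re a < 1)))"
proof (intro conjI allI impI)
  fix n :: nat and a :: complex
  assume n: "6 \<le> n" and "poly (ehrhart_poly n (hypersimplex 3 n)) a = 0"
  then have root: "poly (katzman_poly 3 n) a = 0"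
    by (simp add: ehrhart_poly_hypersimplex)
  show "- (real n / 3) < Re a" "Re a < 0"
  proof (atomize (full), cases "n = 6")
    case True
    then show "- (real n / 3) < Re a \<and> Re a < 0" using roots_d3_n6[of a] root by simp
  next
    case False
    then have "7 \<le> n" using n by simp
    then show "- (real n / 3) < Re a \<and> Re a < 0"
      using root_Re_greater[of 3 n a] dominated_left_d3 root_d3_Re_less_0[of n a] root by auto
  qed
next
  fix d :: nat assume d: "4 \<le> d"
  obtain N where N: "\<And>n w. N \<le> n \<Longrightarrow> 0 \<le> Re w \<Longrightarrow>
      (\<Sum>s=1..<d. real (n choose s) * cmod (shifted_prod d s n w)) < cmod (shifted_prod d 0 n w)"
    using eventually_dominated_left[of d] d by auto
  show "\<exists>N::nat. \<forall>n::nat. n \<ge> N \<and> n \<ge> 2 * d \<longrightarrow>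
               (\<forall>a::complex. poly (ehrhart_poly n (hypersimplex d n)) a = 0 \<longrightarrow>
                  - (real n / real d) < Re a \<and> Re a < 1)"
  proof (intro exI[of _ "max N (4 * d ^ 3)"] allI impI)
    fix n :: nat and a :: complex
    assume n: "max N (4 * d ^ 3) \<le> n \<and> 2 * d \<le> n" and "poly (ehrhart_poly n (hypersimplex d n)) a = 0"
    then have root: "poly (katzman_poly d n) a = 0"
      using d by (simp add: ehrhart_poly_hypersimplex)
    have "- (real n / real d) < Re a"
      using n d by (intro root_Re_greater[OF _ root] N) auto
    moreover have "Re a < 1"
      using n d by (intro root_Re_less_1[OF _ _ root]) auto
    ultimately show "- (real n / real d) < Re a \<and> Re a < 1" by blast
  qed
qed

end
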